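(* Let $d^*\in\{1,\dots,S\}$ be a comparison depth maximizing $h_3(d)$ over $d\in\{1,\dots,S\}$. Then the uniform design $\bar\xi_{d^*}$ on $\mathcal{X}^{(S)}_{d^*}$ is $D$-optimal for the vector of second-order interaction effects $(\boldsymbol\beta_{k\ell m})_{k<\ell<m}$, i.e. it maximizes the determinant of the information matrix for this subvector of parameters (the Schur complement of the main-effect and first-order-interaction block in $\mathbf{M}(\xi)$) over all approximate designs $\xi$ on $\mathcal{X}^{(S)}$.
   Context: Fix integers $v\ge 2$, $K\ge 3$ and $S$ with $3\le S\le K$. Let $\mathbf{e}_i$ denote the $i$th unit vector of $\mathbb{R}^{v-1}$ and $\mathbf{1}_{v-1}$ the all-ones vector. Define $\mathbf{f}_1:\{0,1,\dots,v\}\to\mathbb{R}^{v-1}$ by $\mathbf{f}_1(i)=\mathbf{e}_i$ for $1\le i\le v-1$, $\mathbf{f}_1(v)=-\mathbf{1}_{v-1}$, $\mathbf{f}_1(0)=\mathbf{0}$. Consider the linear paired comparison model $Y(\mathbf{i},\mathbf{j})=(\mathbf{f}(\mathbf{i})-\mathbf{f}(\mathbf{j}))^\top\boldsymbol\beta+\varepsilon$ with uncorrelated homoscedastic zero-mean errors, where $\mathbf{f}(\mathbf{i})$ stacks $\mathbf{f}_1(i_k)$ ($k=1,\dots,K$), then $\mathbf{f}_1(i_k)\otimes\mathbf{f}_1(i_\ell)$ ($k<\ell$), then $\mathbf{f}_1(i_k)\otimes\mathbf{f}_1(i_\ell)\otimes\mathbf{f}_1(i_m)$ ($k<\ell<m$),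 and correspondingly $\boldsymbol\beta=((\boldsymbol\beta_k)_k,(\boldsymbol\beta_{k\ell})_{k<\ell},(\boldsymbol\beta_{k\ell m})_{k<\ell<m})$ (main effects, first-order and second-order interactions). The design region $\mathcal{X}^{(S)}$ is the set of ordered pairs $(\mathbf{i},\mathbf{j})$ in $\{0,\dots,v\}^K$ for which there is a set $A$ of exactly $S$ attributes with $i_k,j_k\in\{1,\dots,v\}$ for $k\in A$ and $i_k=j_k=0$ for $k\notin A$; $\mathcal{X}^{(S)}_d$ is the subset with $i_k\ne j_k$ for exactly $d$ indices $k$. An approximate design is a finitely supported probability measure $\xi$ on $\mathcal{X}^{(S)}$ with information matrix $\mathbf{M}(\xi)=\sum\xi(\mathbf{i},\mathbf{j})(\mathbf{f}(\mathbf{i})-\mathbf{f}(\mathbf{j}))(\mathbf{f}(\mathbf{i})-\mathbf{f}(\mathbf{j}))^\top$; $\bar\xi_d$ is the uniform design on $\mathcal{X}^{(S)}_d$. The function is $h_3(d)=\frac{d\lambda(d)}{4v^2K(K-1)(K-2)}$ with $\lambda(d)=3S^2+3S^2v^2-6S^2v-3Sdv^2+3Sdv-6Sv^2+15Sv-9S+d^2v^2+3dv^2-6dv+2v^2-6v+6$. *)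

theory Defs
  imports Complex_Main "Jordan_Normal_Form.Determinant"
begin

text \<open>Attribute levels are 0..v (0 = attribute not shown). Profiles are lists of length K.
Regression vectors are represented as real lists; the order within each block is fixed
(lexicographic), with blocks: main effects, first-order, second-order interactions.\<close>

definition f1 :: "nat \<Rightarrow> nat \<Rightarrow> real list" where
  "f1 v i = map (\<lambda>r. if i = v then -1 else if i = r + 1 then 1 else 0) [0..<v-1]"

definition kron :: "real list \<Rightarrow> real list \<Rightarrow> real list" where
  "kron xs ys = concat (map (\<lambda>x. map (\<lambda>y. x * y) ys) xs)"

definition fvec :: "nat \<Rightarrow> nat \<Rightarrow> nat list \<Rightarrow> real list" where
  "fvec v K i =
     concat (map (\<lambda>k. f1 v (i!k)) [0..<K])
   @ concat [kron (f1 v (i!k)) (f1 v (i!l)). k \<leftarrow> [0..<K], l \<leftarrow> [Suc k..<K]]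
   @ concat [kron (kron (f1 v (i!k)) (f1 v (i!l))) (f1 v (i!m)).
               k \<leftarrow> [0..<K], l \<leftarrow> [Suc k..<K], m \<leftarrow> [Suc l..<K]]"

definition p12 :: "nat \<Rightarrow> nat \<Rightarrow> nat" where
  "p12 v K = K * (v - 1) + (K choose 2) * (v - 1)^2"

definition p3 :: "nat \<Rightarrow> nat \<Rightarrow> nat" where
  "p3 v K = (K choose 3) * (v - 1)^3"

definition dvec :: "nat \<Rightarrow> nat \<Rightarrow> nat list \<times> nat list \<Rightarrow> real list" where
  "dvec v K x = map2 (-) (fvec v K (fst x)) (fvec v K (snd x))"

definition design_region :: "nat \<Rightarrow> nat \<Rightarrow> nat \<Rightarrow> (nat list \<times> nat list) set" where
  "design_region v K S = {(i, j). length i = K \<and> length j = K \<and>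
     (\<exists>A. A \<subseteq> {0..<K} \<and> card A = S \<and>
        (\<forall>k\<in>A. i!k \<in> {1..v} \<and> j!k \<in> {1..v}) \<and>
        (\<forall>k<K. k \<notin> A \<longrightarrow> i!k = 0 \<and> j!k = 0))}"

definition design_region_d :: "nat \<Rightarrow> nat \<Rightarrow> nat \<Rightarrow> nat \<Rightarrow> (nat list \<times> nat list) set" where
  "design_region_d v K S d = {x \<in> design_region v K S. card {k. k < K \<and> fst x ! k \<noteq> snd x ! k} = d}"

definition is_design :: "nat \<Rightarrow> nat \<Rightarrow> nat \<Rightarrow> (nat list \<times> nat list \<Rightarrow> real) \<Rightarrow> bool" where
  "is_design v K S \<xi> \<longleftrightarrow> (\<forall>x. 0 \<le> \<xi> x) \<and> (\<forall>x. x \<notin> design_region v K S \<longrightarrow> \<xi> x = 0)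
      \<and> (\<Sum>x\<in>design_region v K S. \<xi> x) = 1"

definition uniform_design :: "nat \<Rightarrow> nat \<Rightarrow> nat \<Rightarrow> nat \<Rightarrow> nat list \<times> nat list \<Rightarrow> real" where
  "uniform_design v K S d x =
     (if x \<in> design_region_d v K S d then 1 / real (card (design_region_d v K S d)) else 0)"

definition info_mat :: "nat \<Rightarrow> nat \<Rightarrow> nat \<Rightarrow> (nat list \<times> nat list \<Rightarrow> real) \<Rightarrow> real mat" where
  "info_mat v K S \<xi> = mat (p12 v K + p3 v K) (p12 v K + p3 v K)
     (\<lambda>(a, b). \<Sum>x\<in>design_region v K S. \<xi> x * (dvec v K x ! a) * (dvec v K x ! b))"

definition schur_compl :: "nat \<Rightarrow> nat \<Rightarrow> real mat \<Rightarrow> real mat" where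
  "schur_compl q r M =
     (let A = mat q q (\<lambda>(a, b). M $$ (a, b));
          B = mat q r (\<lambda>(a, b). M $$ (a, q + b));
          C = mat r q (\<lambda>(a, b). M $$ (q + a, b));
          D = mat r r (\<lambda>(a, b). M $$ (q + a, q + b));
          G = (SOME G. G \<in> carrier_mat q q \<and> A * G * A = A)
      in D - C * G * B)"

definition info_mat3 :: "nat \<Rightarrow> nat \<Rightarrow> nat \<Rightarrow> (nat list \<times> nat list \<Rightarrow> real) \<Rightarrow> real mat" where
  "info_mat3 v K S \<xi> = schur_compl (p12 v K) (p3 v K) (info_mat v K S \<xi>)"

definition h3 :: "nat \<Rightarrow> nat \<Rightarrow> nat \<Rightarrow> nat \<Rightarrow> real" where
  "h3 v K S d' = (let v = real v; K = real K; S = real S; d = real d';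
     lam = 3*S^2 + 3*S^2*v^2 - 6*S^2*v - 3*S*d*v^2 + 3*S*d*v - 6*S*v^2 + 15*S*v - 9*S
           + d^2*v^2 + 3*d*v^2 - 6*d*v + 2*v^2 - 6*v + 6
     in d * lam / (4 * v^2 * K * (K - 1) * (K - 2)))"

end

theory Submission
  imports Defs "Jordan_Normal_Form.Schur_Decomposition"
begin

text \<open>
  Under the uniform design on pairs of depth \<open>d\<close> the contributions of different effects are
  uncorrelated, because the levels of each attribute are balanced and the components of \<open>f1\<close> sum to
  zero over the levels. Hence the Schur complement is just the block of second-order interactions,
  and this block is a multiple \<open>c\<close> of \<open>I \<otimes> G \<otimes> G \<otimes> G\<close> with \<open>G = I + J\<close>, where \<open>c\<close> is the same for all
  triples of attributes by symmetry. With \<open>P\<close> the resulting matrix, of order \<open>p\<close>, the quadratic form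
  of \<open>P\<close> inverse at the regression vector of a pair depends only on the depth of the pair and is
  proportional to \<open>h3\<close>. Averaging it over the design gives \<open>p\<close>, so it is at most \<open>p\<close> at every pair
  exactly because \<open>dstar\<close> maximises \<open>h3\<close>.

  For an arbitrary design the Schur complement \<open>N\<close> is a Gram matrix dominated by the block of
  second-order interactions, so the trace of \<open>N\<close> times \<open>P\<close> inverse is at most \<open>p\<close>. The eigenvalues
  \<open>e\<close> of this product are real and nonnegative, and \<open>e \<le> exp (e - 1)\<close> shows that their product is at
  most one, i.e. \<open>det N \<le> det P\<close>.
\<close>

section \<open>Determinants of Gram matrices and Schur complements\<close>

lemma index_mult_mat_sum:
  assumes "A \<in> carrier_mat n m" "B \<in> carrier_mat m l" "i < n" "j < l"
  shows "(A * B) $$ (i, j) = (\<Sum>k<m. A $$ (i, k) * B $$ (k, j))"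
  using assms by (simp add: scalar_prod_def lessThan_atLeast0)

lemma trace_mult_commute:
  fixes A B :: "'a :: comm_semiring_0 mat"
  assumes A: "A \<in> carrier_mat n m" and B: "B \<in> carrier_mat m n"
  shows "(\<Sum>i<n. (A * B) $$ (i, i)) = (\<Sum>i<m. (B * A) $$ (i, i))"
proof -
  have "(\<Sum>i<n. (A * B) $$ (i, i)) = (\<Sum>i<n. \<Sum>k<m. A $$ (i, k) * B $$ (k, i))"
    using index_mult_mat_sum[OF A B] by simp
  also have "\<dots> = (\<Sum>k<m. \<Sum>i<n. A $$ (i, k) * B $$ (k, i))" by (rule sum.swap)
  also have "\<dots> = (\<Sum>k<m. (B * A) $$ (k, k))"
    using index_mult_mat_sum[OF B A] by (simp add: mult.commute)
  finally show ?thesis .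
qed

text \<open>Makes the choice of \<open>G\<close> in \<open>schur_compl\<close> meaningful.
  Gauss-Jordan elimination gives an echelon form \<open>E = P * A\<close> with \<open>P\<close>
  invertible. If \<open>E * H * E = E\<close>, then cancelling \<open>P\<close> on the left shows
  that \<open>H * P\<close> is a generalized inverse of \<open>A\<close>.\<close>

lemma exists_generalized_inverse:
  fixes A :: "'a :: field mat"
  assumes A: "A \<in> carrier_mat n n"
  shows "\<exists>G. G \<in> carrier_mat n n \<and> A * G * A = A"
proof -
  define E where "E = gauss_jordan_single A"
  from gauss_jordan_single[OF A E_def[symmetric]] obtain P Q
    where E: "E \<in> carrier_mat n n" "row_echelon_form E"
      and PQ: "E = P * A" "P \<in> carrier_mat n n" "Q \<in> carrier_mat n n" "Q * P = 1\<^sub>m n"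
    by blast
  from E obtain f where f: "pivot_fun E f n" by (auto simp: row_echelon_form_def)
  have dE: "dim_row E = n" using E by simp
  note pf = pivot_funD[OF dE f]
  \<comment> \<open>The pivot columns of \<open>E\<close> are unit vectors, and \<open>H\<close> selects them.\<close>
  define H where "H = mat n n (\<lambda>(j, i). if j = f i then 1 else 0 :: 'a)"
  have H: "H \<in> carrier_mat n n" by (simp add: H_def)
  have EH: "(E * H) $$ (i, j) = (if f j < n then E $$ (i, f j) else 0)" if "i < n" "j < n" for i j
    using that by (subst index_mult_mat_sum[OF E(1) H]) (auto simp: H_def if_distrib[of "(*) _"] sum.If_cases
      simp del: mult_cancel_left1 cong: if_cong)
  have "E * H * E = E"
  proof (rule eq_matI)
    fix i j assume "i < dim_row E" "j < dim_col E"
    then have ij: "i < n" "j < n" using E by auto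
    have "(E * H * E) $$ (i, j) = (\<Sum>k<n. (E * H) $$ (i, k) * E $$ (k, j))"
      using E H ij by (intro index_mult_mat_sum) auto
    also have "\<dots> = (\<Sum>k<n. if k = i then E $$ (i, j) else 0)"
    proof (rule sum.cong[OF refl])
      fix k assume "k \<in> {..<n}"
      then have k: "k < n" by simp
      show "(E * H) $$ (i, k) * E $$ (k, j) = (if k = i then E $$ (i, j) else 0)"
      proof (cases "f k < n")
        case True
        then show ?thesis using EH[OF ij(1) k] pf(4)[OF k True] pf(5)[OF k True ij(1)] by auto
      next
        case False
        then have "f k = n" using pf(1)[OF k] by simp
        then have "E $$ (k, j) = 0" using pf(2)[OF k] ij by simp
        then show ?thesis by auto
      qed
    qed
    also have "\<dots> = E $$ (i, j)" using ij by simp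
    finally show "(E * H * E) $$ (i, j) = E $$ (i, j)" .
  qed (use E H in auto)
  note [simp] = assoc_mult_mat[of _ n n _ n _ n]
  have "Q * (E * H * E) = Q * E" using \<open>E * H * E = E\<close> by simp
  moreover have "Q * E = A" using PQ A assoc_mult_mat[of Q n n P n A n] by simp
  moreover have "Q * (E * H * E) = (Q * E) * (H * P) * A" using PQ(2,3) A H E
    by (simp add: PQ(1))
  ultimately have "A * (H * P) * A = A" by simp
  then show ?thesis using H PQ by (intro exI[of _ "H * P"]) auto
qed

section \<open>Gram matrices, their eigenvalues and determinants\<close>

text \<open>Information matrix of the weights \<open>\<xi>\<close>. Regressors are functions of
  point and index, so that regression vectors, residuals and unit vectors are all covered.\<close>

definition gram :: "'x set \<Rightarrow> ('x \<Rightarrow> real) \<Rightarrow> ('x \<Rightarrow> nat \<Rightarrow> real) \<Rightarrow> nat \<Rightarrow> real mat" where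
  "gram X \<xi> f n = mat n n (\<lambda>(a, b). \<Sum>x\<in>X. \<xi> x * f x a * f x b)"

lemma gram_carrier [simp]: "gram X \<xi> f n \<in> carrier_mat n n"
  by (simp add: gram_def)

lemma gram_dim [simp]: "dim_row (gram X \<xi> f n) = n" "dim_col (gram X \<xi> f n) = n"
  by (simp_all add: gram_def)

lemma index_gram [simp]:
  "a < n \<Longrightarrow> b < n \<Longrightarrow> gram X \<xi> f n $$ (a, b) = (\<Sum>x\<in>X. \<xi> x * f x a * f x b)"
  by (simp add: gram_def)

text \<open>Over the complex numbers the characteristic polynomial splits, and the triangular Schur
  form, being similar to \<open>A\<close>, has the same determinant and trace. The list carries
  multiplicities.\<close>

lemma complex_det_trace:
  fixes A :: "complex mat"
  assumes A: "A \<in> carrier_mat n n"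
  obtains es where "length es = n" "\<And>e. e \<in> set es \<Longrightarrow> eigenvalue A e"
    "det A = prod_list es" "(\<Sum>i<n. A $$ (i, i)) = sum_list es"
proof -
  from char_poly_factorized[OF A] obtain es
    where es: "char_poly A = (\<Prod>a\<leftarrow>es. [:- a, 1:])" "length es = n" by blast
  obtain B P Q where sd: "schur_decomposition A es = (B, P, Q)"
    by (cases "schur_decomposition A es") auto
  from schur_decomposition[OF A es(1) sd]
  have sim: "similar_mat_wit A B P Q" and B: "upper_triangular B" "diag_mat B = es" by auto
  note w = similar_mat_witD2[OF A sim]
  have "eigenvalue A e" if "e \<in> set es" for e
    using that unfolding eigenvalue_root_char_poly[OF A] es(1) poly_prod_list
    by (force simp: prod_list_zero_iff)
  moreover have "det A = prod_list es"
    using det_similar[of A B] sim det_upper_triangular[OF B(1) w(5)] B(2)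
    unfolding similar_mat_def by auto
  moreover have "(\<Sum>i<n. A $$ (i, i)) = sum_list es"
  proof -
    have "(\<Sum>i<n. A $$ (i, i)) = (\<Sum>i<n. (P * (B * Q)) $$ (i, i))"
      using w by (simp add: assoc_mult_mat[of P n n B n Q n])
    also have "\<dots> = (\<Sum>i<n. ((B * Q) * P) $$ (i, i))"
      using w by (intro trace_mult_commute) auto
    also have "(B * Q) * P = B" using w by (simp add: assoc_mult_mat[of B n n Q n P n])
    also have "(\<Sum>i<n. B $$ (i, i)) = sum_list es"
      using w(5) by (simp add: B(2)[symmetric] diag_mat_def sum_list_sum_nth lessThan_atLeast0)
    finally show ?thesis .
  qed
  ultimately show ?thesis using that es(2) by blast
qed

text \<open>Multiply the inequalities \<open>x \<le> exp (x - 1)\<close> over the list; this takes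
  the place of the inequality of arithmetic and geometric means.\<close>

lemma prod_list_le_exp:
  fixes xs :: "real list"
  assumes "\<And>x. x \<in> set xs \<Longrightarrow> 0 \<le> x"
  shows "0 \<le> prod_list xs" "prod_list xs \<le> exp (sum_list xs - length xs)"
proof -
  show "0 \<le> prod_list xs" using assms by (induction xs) auto
  show "prod_list xs \<le> exp (sum_list xs - length xs)" using assms
  proof (induction xs)
    case (Cons x xs)
    have "x \<le> exp (x - 1)" using exp_ge_add_one_self[of "x - 1"] by simp
    moreover have "prod_list xs \<le> exp (sum_list xs - length xs)" using Cons by auto
    moreover have "0 \<le> prod_list ys" if "\<And>y. y \<in> set ys \<Longrightarrow> 0 \<le> y" for ys :: "real list"
      using that by (induction ys) auto
    ultimately have "x * prod_list xs \<le> exp (x - 1) * exp (sum_list xs - length xs)"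
      using Cons(2) by (intro mult_mono) auto
    then show ?case by (simp add: exp_add[symmetric] algebra_simps)
  qed simp
qed

text \<open>The matrices of interest are products of two Gram-type matrices and hence rarely
  symmetric, so real eigenvalues have to be assumed of the complexification. If the trace is at most
  \<open>n\<close>, the exponent in \<open>prod_list_le_exp\<close> is at most 0.\<close>

lemma det_bounds_of_nonneg_eigenvalues:
  fixes A :: "real mat"
  assumes A: "A \<in> carrier_mat n n"
    and ev: "\<And>e. eigenvalue (map_mat complex_of_real A) e \<Longrightarrow> \<exists>t\<ge>0. e = complex_of_real t"
  shows "0 \<le> det A" "(\<Sum>i<n. A $$ (i, i)) \<le> real n \<Longrightarrow> det A \<le> 1"
proof -
  let ?A = "map_mat complex_of_real A"
  have cA: "?A \<in> carrier_mat n n" using A by simp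
  obtain es where es: "length es = n" "\<And>e. e \<in> set es \<Longrightarrow> eigenvalue ?A e"
    "det ?A = prod_list es" "(\<Sum>i<n. ?A $$ (i, i)) = sum_list es"
    using complex_det_trace[OF cA] by blast
  define rs where "rs = map Re es"
  have es_rs: "es = map complex_of_real rs"
    using es(2) ev unfolding rs_def by (force intro!: nth_equalityI simp: in_set_conv_nth)
  have rs0: "0 \<le> r" if "r \<in> set rs" for r
    using that es(2) ev unfolding rs_def by force
  have hp: "prod_list (map complex_of_real xs) = complex_of_real (prod_list xs)" for xs
    by (induction xs) auto
  have hs: "sum_list (map complex_of_real xs) = complex_of_real (sum_list xs)" for xs
    by (induction xs) auto
  have "complex_of_real (det A) = complex_of_real (prod_list rs)"
    using es(3) of_real_hom.hom_det[of A] hp by (simp add: es_rs)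
  then have d: "det A = prod_list rs" by (simp only: of_real_eq_iff)
  have "complex_of_real (\<Sum>i<n. A $$ (i, i)) = complex_of_real (sum_list rs)"
    using es(4) A hs by (simp add: es_rs)
  then have s: "(\<Sum>i<n. A $$ (i, i)) = sum_list rs" by (simp only: of_real_eq_iff)
  show "0 \<le> det A" using d prod_list_le_exp(1)[of rs] rs0 by simp
  show "det A \<le> 1" if "(\<Sum>i<n. A $$ (i, i)) \<le> real n"
  proof -
    have "prod_list rs \<le> exp (sum_list rs - length rs)" using prod_list_le_exp(2)[of rs] rs0 by simp
    also have "\<dots> \<le> 1" using that s es(1) by (simp add: rs_def)
    finally show ?thesis using d by simp
  qed
qed

lemma gram_mult_complex_vec:
  assumes "a < n" "t \<in> carrier_vec n"
  shows "(map_mat complex_of_real (gram X \<xi> f n) *\<^sub>v t) $ a =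
    (\<Sum>x\<in>X. complex_of_real (\<xi> x * f x a) * (\<Sum>b<n. complex_of_real (f x b) * t $ b))"
proof -
  have "(map_mat complex_of_real (gram X \<xi> f n) *\<^sub>v t) $ a =
      (\<Sum>b<n. \<Sum>x\<in>X. complex_of_real (\<xi> x * f x a) * (complex_of_real (f x b) * t $ b))"
    using assms by (simp add: gram_def scalar_prod_def lessThan_atLeast0 sum_distrib_right mult.assoc)
  then show ?thesis by (subst (asm) sum.swap) (simp add: sum_distrib_left)
qed

text \<open>A complex vector is allowed because eigenvectors of a nonsymmetric real matrix are
  complex a priori. The right-hand side is visibly real, and nonnegative for nonnegative
  weights.\<close>

lemma gram_hermitian_form:
  assumes "t \<in> carrier_vec n"
  shows "(\<Sum>a<n. cnj (t $ a) * (map_mat complex_of_real (gram X \<xi> f n) *\<^sub>v t) $ a) =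
    complex_of_real (\<Sum>x\<in>X. \<xi> x * (cmod (\<Sum>b<n. complex_of_real (f x b) * t $ b))\<^sup>2)"
proof -
  let ?s = "\<lambda>x. \<Sum>b<n. complex_of_real (f x b) * t $ b"
  have "(\<Sum>a<n. cnj (t $ a) * (map_mat complex_of_real (gram X \<xi> f n) *\<^sub>v t) $ a) =
      (\<Sum>a<n. \<Sum>x\<in>X. complex_of_real (\<xi> x) * (complex_of_real (f x a) * cnj (t $ a)) * ?s x)"
    using assms by (simp add: gram_mult_complex_vec sum_distrib_left mult_ac del: index_mult_mat_vec)
  also have "\<dots> = (\<Sum>x\<in>X. \<Sum>a<n. complex_of_real (\<xi> x) * (complex_of_real (f x a) * cnj (t $ a)) * ?s x)"
    by (rule sum.swap)
  also have "\<dots> = (\<Sum>x\<in>X. complex_of_real (\<xi> x) * (?s x * cnj (?s x)))"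
    by (simp add: sum_distrib_left sum_distrib_right mult_ac)
  also have "\<dots> = (\<Sum>x\<in>X. complex_of_real (\<xi> x * (cmod (?s x))\<^sup>2))"
    by (simp only: complex_norm_square[symmetric] of_real_mult)
  finally show ?thesis by simp
qed

text \<open>Let \<open>N\<close> and \<open>P\<close> be the two Gram matrices. With
  \<open>t = R z\<close> the eigenvalue equation for \<open>N * R\<close> becomes the generalized
  problem \<open>N t = e (P t)\<close>. Pairing it with the conjugate of \<open>t\<close> expresses
  \<open>e\<close> as a quotient of two nonnegative Hermitian forms.\<close>

lemma gram_mult_inverse_gram_eigenvalue:
  assumes X: "finite X" "\<And>x. x \<in> X \<Longrightarrow> 0 \<le> \<xi> x"
    and Y: "finite Y" "\<And>y. y \<in> Y \<Longrightarrow> 0 \<le> \<eta> y"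
    and R: "R \<in> carrier_mat n n" "gram Y \<eta> g n * R = 1\<^sub>m n"
    and ev: "eigenvalue (map_mat complex_of_real (gram X \<xi> f n * R)) e"
  shows "\<exists>s\<ge>0. e = complex_of_real s"
proof -
  let ?c = "map_mat complex_of_real"
  let ?N = "?c (gram X \<xi> f n)" and ?P = "?c (gram Y \<eta> g n)" and ?R = "?c R"
  from ev obtain z where z: "z \<in> carrier_vec n" "z \<noteq> 0\<^sub>v n" and
    ez: "?c (gram X \<xi> f n * R) *\<^sub>v z = e \<cdot>\<^sub>v z"
    using R by (auto simp: eigenvalue_def eigenvector_def)
  define t where "t = ?R *\<^sub>v z"
  have t: "t \<in> carrier_vec n" using R z by (simp add: t_def)
  have cN: "?N \<in> carrier_mat n n" and cP: "?P \<in> carrier_mat n n" and cR: "?R \<in> carrier_mat n n"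
    using R by simp_all
  have "?c (gram X \<xi> f n * R) = ?N * ?R" using of_real_hom.mat_hom_mult[OF gram_carrier R(1)] .
  then have Nt: "?N *\<^sub>v t = e \<cdot>\<^sub>v z" using ez assoc_mult_mat_vec[OF cN cR z(1)] by (simp add: t_def)
  have "?c (gram Y \<eta> g n * R) = ?P * ?R" using of_real_hom.mat_hom_mult[OF gram_carrier R(1)] .
  then have "?P * ?R = 1\<^sub>m n" using R(2) by (simp add: of_real_hom.mat_hom_one)
  then have Pt: "?P *\<^sub>v t = z" using assoc_mult_mat_vec[OF cP cR z(1)] z(1) by (simp add: t_def)
  let ?\<alpha> = "\<Sum>x\<in>X. \<xi> x * (cmod (\<Sum>b<n. complex_of_real (f x b) * t $ b))\<^sup>2"
  let ?\<beta> = "\<Sum>y\<in>Y. \<eta> y * (cmod (\<Sum>b<n. complex_of_real (g y b) * t $ b))\<^sup>2"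
  have "complex_of_real ?\<alpha> = (\<Sum>a<n. cnj (t $ a) * (e * z $ a))"
    using gram_hermitian_form[OF t, of X \<xi> f] Nt z by simp
  also have "\<dots> = e * (\<Sum>a<n. cnj (t $ a) * z $ a)" by (simp add: sum_distrib_left mult_ac)
  also have "(\<Sum>a<n. cnj (t $ a) * z $ a) = complex_of_real ?\<beta>"
    using gram_hermitian_form[OF t, of Y \<eta> g] Pt by simp
  finally have eq: "complex_of_real ?\<alpha> = e * complex_of_real ?\<beta>" .
  \<comment> \<open>A vanishing form forces every linear form \<open>g y\<close> to vanish at
    \<open>t\<close> wherever \<open>\<eta>\<close> has weight, hence \<open>P t = 0\<close>; but
    \<open>P t\<close> is the eigenvector \<open>z\<close>.\<close>
  have "?\<beta> \<noteq> 0"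
  proof
    assume "?\<beta> = 0"
    then have "\<forall>y\<in>Y. \<eta> y * (cmod (\<Sum>b<n. complex_of_real (g y b) * t $ b))\<^sup>2 = 0"
      using Y by (subst (asm) sum_nonneg_eq_0_iff) auto
    then have "\<forall>y\<in>Y. \<eta> y = 0 \<or> (\<Sum>b<n. complex_of_real (g y b) * t $ b) = 0" by auto
    then have "(?P *\<^sub>v t) $ a = 0" if "a < n" for a
      using gram_mult_complex_vec[OF that t, of Y \<eta> g] by (auto intro!: sum.neutral)
    then have "z = 0\<^sub>v n" using Pt z(1) by (intro eq_vecI) auto
    then show False using z by simp
  qed
  then have "e = complex_of_real (?\<alpha> / ?\<beta>)" using eq by (simp add: field_simps del: of_real_sum)
  moreover have "0 \<le> ?\<alpha>" "0 \<le> ?\<beta>" using X Y by (auto intro!: sum_nonneg)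
  ultimately show ?thesis by (intro exI[of _ "?\<alpha> / ?\<beta>"]) auto
qed

text \<open>The identity is the Gram matrix of the unit vectors and is its own inverse, so the
  preceding lemma applies with \<open>R\<close> the identity.\<close>

lemma det_gram_nonneg:
  assumes "finite X" "\<And>x. x \<in> X \<Longrightarrow> 0 \<le> \<xi> x"
  shows "0 \<le> det (gram X \<xi> f n)"
proof (rule det_bounds_of_nonneg_eigenvalues(1)[OF gram_carrier])
  have id: "gram {..<n} (\<lambda>_. 1) (\<lambda>x a. if x = a then 1 else 0) n = 1\<^sub>m n"
    by (rule eq_matI) (auto simp: gram_def if_distrib[of "\<lambda>u. u * _"] cong: if_cong)
  fix e assume "eigenvalue (map_mat complex_of_real (gram X \<xi> f n)) e"
  then show "\<exists>t\<ge>0. e = complex_of_real t"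
    using id by (intro gram_mult_inverse_gram_eigenvalue[where R = "1\<^sub>m n" and Y = "{..<n}"
      and \<eta> = "\<lambda>_. 1" and g = "\<lambda>x a. if x = a then 1 else 0" and f = f and n = n, OF assms]) auto
qed

text \<open>The assumption \<open>tr\<close> says that the trace of \<open>N * R\<close> is at most
  \<open>n\<close>, where \<open>R\<close> inverts the Gram matrix \<open>P\<close> on the right.
  Hence \<open>det N * det R \<le> 1\<close>, and multiplying by \<open>det P\<close>, which is
  nonnegative, gives the claim.\<close>

lemma det_gram_le:
  assumes X: "finite X" "\<And>x. x \<in> X \<Longrightarrow> 0 \<le> \<xi> x"
    and Y: "finite Y" "\<And>y. y \<in> Y \<Longrightarrow> 0 \<le> \<eta> y"
    and R: "R \<in> carrier_mat n n" "gram Y \<eta> g n * R = 1\<^sub>m n"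
    and tr: "(\<Sum>x\<in>X. \<xi> x * (\<Sum>a<n. \<Sum>b<n. f x a * R $$ (a, b) * f x b)) \<le> real n"
  shows "det (gram X \<xi> f n) \<le> det (gram Y \<eta> g n)"
proof -
  let ?N = "gram X \<xi> f n" and ?P = "gram Y \<eta> g n"
  have "(\<Sum>b<n. (?N * R) $$ (b, b)) = (\<Sum>b<n. \<Sum>a<n. \<Sum>x\<in>X. \<xi> x * (f x a * R $$ (a, b) * f x b))"
    by (simp add: index_mult_mat_sum[OF gram_carrier R(1)] sum_distrib_left mult_ac)
  also have "\<dots> = (\<Sum>a<n. \<Sum>b<n. \<Sum>x\<in>X. \<xi> x * (f x a * R $$ (a, b) * f x b))" by (rule sum.swap)
  also have "\<dots> = (\<Sum>a<n. \<Sum>x\<in>X. \<Sum>b<n. \<xi> x * (f x a * R $$ (a, b) * f x b))"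
    by (rule sum.cong[OF refl sum.swap])
  also have "\<dots> = (\<Sum>x\<in>X. \<Sum>a<n. \<Sum>b<n. \<xi> x * (f x a * R $$ (a, b) * f x b))" by (rule sum.swap)
  finally have "(\<Sum>b<n. (?N * R) $$ (b, b)) \<le> real n" using tr by (simp add: sum_distrib_left)
  then have "det (?N * R) \<le> 1"
  proof (rule det_bounds_of_nonneg_eigenvalues(2)[rotated 2])
    fix e assume "eigenvalue (map_mat complex_of_real (?N * R)) e"
    then show "\<exists>t\<ge>0. e = complex_of_real t"
      using X(2) Y(2) by (rule gram_mult_inverse_gram_eigenvalue[OF X(1) _ Y(1) _ R, rotated 2])
  qed (rule mult_carrier_mat[OF gram_carrier R(1)])
  then have 1: "det ?N * det R \<le> 1" by (simp add: det_mult[OF gram_carrier R(1)])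
  have 2: "det ?P * det R = 1" using det_mult[OF gram_carrier R(1)] R(2) by (metis det_one)
  have "det ?N * det R * det ?P \<le> 1 * det ?P"
    using 1 det_gram_nonneg[OF Y] by (intro mult_right_mono) auto
  then show ?thesis using 2 by (simp add: mult.assoc mult.commute[of "det R"])
qed

section \<open>Schur complements as Gram matrices of residuals\<close>

lemma sum_weighted_linear_forms:
  fixes \<xi> :: "'x \<Rightarrow> real"
  shows "(\<Sum>x\<in>X. \<xi> x * (\<Sum>c\<in>I. \<alpha> c * u x c) * (\<Sum>d\<in>J. \<beta> d * w x d)) =
    (\<Sum>c\<in>I. \<Sum>d\<in>J. \<alpha> c * (\<Sum>x\<in>X. \<xi> x * u x c * w x d) * \<beta> d)"
proof -
  have "(\<Sum>x\<in>X. \<xi> x * (\<Sum>c\<in>I. \<alpha> c * u x c) * (\<Sum>d\<in>J. \<beta> d * w x d)) =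
      (\<Sum>x\<in>X. \<Sum>c\<in>I. \<Sum>d\<in>J. \<alpha> c * (\<xi> x * u x c * w x d) * \<beta> d)"
    by (simp add: sum_distrib_left sum_distrib_right mult_ac)
  also have "\<dots> = (\<Sum>c\<in>I. \<Sum>x\<in>X. \<Sum>d\<in>J. \<alpha> c * (\<xi> x * u x c * w x d) * \<beta> d)" by (rule sum.swap)
  also have "\<dots> = (\<Sum>c\<in>I. \<Sum>d\<in>J. \<Sum>x\<in>X. \<alpha> c * (\<xi> x * u x c * w x d) * \<beta> d)"
    by (rule sum.cong[OF refl sum.swap])
  finally show ?thesis by (simp add: sum_distrib_left sum_distrib_right)
qed

text \<open>Normal equations are always solvable, even for singular \<open>A\<close>. The matrix
  \<open>T = A * H - 1\<close> annihilates \<open>A\<close>, so the weighted sum of squares of each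
  component of \<open>T u\<close> is zero. Thus \<open>T u\<close> vanishes at all points with
  weight, and therefore \<open>T * B = 0\<close>.\<close>

lemma gram_normal_equations:
  assumes X: "finite X" "\<And>x. x \<in> X \<Longrightarrow> 0 \<le> \<xi> x"
    and H: "H \<in> carrier_mat q q" "gram X \<xi> u q * H * gram X \<xi> u q = gram X \<xi> u q"
    and B: "B = mat q r (\<lambda>(a, b). \<Sum>x\<in>X. \<xi> x * u x a * w x b)"
  shows "gram X \<xi> u q * (H * B) = B"
proof -
  let ?A = "gram X \<xi> u q"
  define T where "T = ?A * H - 1\<^sub>m q"
  have T: "T \<in> carrier_mat q q" using H by (simp add: T_def minus_carrier_mat)
  have cB: "B \<in> carrier_mat q r" by (simp add: B)
  have TA: "T * ?A = 0\<^sub>m q q"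
    unfolding T_def using H by (subst minus_mult_distrib_mat[of _ q q _ _ q]) (auto intro!: eq_matI)
  have null: "\<xi> x = 0 \<or> (\<Sum>d<q. T $$ (c, d) * u x d) = 0" if "c < q" "x \<in> X" for c x
  proof -
    have "(\<Sum>x\<in>X. \<xi> x * (\<Sum>d<q. T $$ (c, d) * u x d) * (\<Sum>d<q. T $$ (c, d) * u x d)) =
        (\<Sum>d<q. \<Sum>e<q. T $$ (c, d) * ?A $$ (d, e) * T $$ (c, e))"
      by (simp add: sum_weighted_linear_forms)
    also have "\<dots> = (\<Sum>e<q. (T * ?A) $$ (c, e) * T $$ (c, e))"
      using that by (subst sum.swap)
        (simp add: index_mult_mat_sum[OF T gram_carrier] sum_distrib_right del: index_gram index_mult_mat)
    also have "\<dots> = 0" using that by (simp add: TA)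
    finally have "\<forall>x\<in>X. \<xi> x * (\<Sum>d<q. T $$ (c, d) * u x d) * (\<Sum>d<q. T $$ (c, d) * u x d) = 0"
      using X by (subst (asm) sum_nonneg_eq_0_iff) (auto simp: mult.assoc)
    then show ?thesis using that by auto
  qed
  have TB: "T * B = 0\<^sub>m q r"
  proof (rule eq_matI)
    fix c b assume "c < dim_row (0\<^sub>m q r)" "b < dim_col (0\<^sub>m q r)"
    then have cb: "c < q" "b < r" by auto
    have "(T * B) $$ (c, b) = (\<Sum>d<q. \<Sum>e\<in>{b}. T $$ (c, d) * (\<Sum>x\<in>X. \<xi> x * u x d * w x e) * 1)"
      using cb by (subst index_mult_mat_sum[OF T cB]) (simp_all add: B)
    also have "\<dots> = (\<Sum>x\<in>X. \<xi> x * (\<Sum>d<q. T $$ (c, d) * u x d) * (\<Sum>e\<in>{b}. 1 * w x e))"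
      by (rule sum_weighted_linear_forms[symmetric])
    also have "\<dots> = 0" using null[OF cb(1)] by (intro sum.neutral) auto
    finally show "(T * B) $$ (c, b) = 0\<^sub>m q r $$ (c, b)" using cb by simp
  qed (use T cB in auto)
  have "T * B = ?A * (H * B) - B"
    unfolding T_def using H cB by (subst minus_mult_distrib_mat[of _ q q _ _ r])
      (auto simp: assoc_mult_mat[of _ q q _ q _ r])
  then have TB': "?A * (H * B) - B = 0\<^sub>m q r" using TB by simp
  show ?thesis
  proof (rule eq_matI)
    fix i j assume ij: "i < dim_row B" "j < dim_col B"
    then have "(?A * (H * B) - B) $$ (i, j) = 0" using TB' cB by simp
    then show "(?A * (H * B)) $$ (i, j) = B $$ (i, j)"
      using ij by simp
  qed (use cB H in auto)
qed

text \<open>Here \<open>z\<close> is the part of the last \<open>r\<close> components fitted by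
  weighted least squares from the first \<open>q\<close>, so the Schur complement is the Gram matrix
  of the residuals. Residuals are orthogonal to fitted values, which gives the second
  clause.\<close>

lemma schur_compl_gram:
  assumes X: "finite X" "\<And>x. x \<in> X \<Longrightarrow> 0 \<le> \<xi> x"
  shows "\<exists>z. schur_compl q r (gram X \<xi> f (q + r)) = gram X \<xi> (\<lambda>x b. f x (q + b) - z x b) r \<and>
    (\<forall>a<r. \<forall>b<r. (\<Sum>x\<in>X. \<xi> x * (f x (q + a) - z x a) * (f x (q + b) - z x b)) =
      (\<Sum>x\<in>X. \<xi> x * f x (q + a) * f x (q + b)) - (\<Sum>x\<in>X. \<xi> x * z x a * z x b))"
proof -
  let ?M = "gram X \<xi> f (q + r)"
  define A where "A = gram X \<xi> f q"
  define B where "B = mat q r (\<lambda>(a, b). \<Sum>x\<in>X. \<xi> x * f x a * f x (q + b))"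
  define C where "C = mat r q (\<lambda>(a, b). \<Sum>x\<in>X. \<xi> x * f x (q + a) * f x b)"
  define D where "D = gram X \<xi> (\<lambda>x b. f x (q + b)) r"
  define G where "G = (SOME G. G \<in> carrier_mat q q \<and> A * G * A = A)"
  have cA: "A \<in> carrier_mat q q" and cB: "B \<in> carrier_mat q r" and cC: "C \<in> carrier_mat r q"
    and cD: "D \<in> carrier_mat r r"
    by (simp_all add: A_def B_def C_def D_def)
  have G: "G \<in> carrier_mat q q" "A * G * A = A"
    using someI_ex[OF exists_generalized_inverse[OF cA]] unfolding G_def by auto
  have "A = mat q q (\<lambda>(a, b). ?M $$ (a, b))" "B = mat q r (\<lambda>(a, b). ?M $$ (a, q + b))"
    "C = mat r q (\<lambda>(a, b). ?M $$ (q + a, b))" "D = mat r r (\<lambda>(a, b). ?M $$ (q + a, q + b))"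
    by (auto simp: A_def B_def C_def D_def intro!: eq_matI)
  then have S: "schur_compl q r ?M = D - C * G * B"
    by (simp add: schur_compl_def Let_def G_def)
  have At: "A\<^sup>T = A" and Bt: "B\<^sup>T = C"
    by (auto simp: A_def B_def C_def mult_ac intro!: eq_matI sum.cong)
  \<comment> \<open>The chosen \<open>G\<close> need not be symmetric. Since \<open>A\<close> is
    symmetric, the transpose of \<open>G\<close> is again a generalized inverse, and the columns of
    \<open>Z\<close> solve the normal equations.\<close>
  define Z where "Z = G\<^sup>T * B"
  have cZ: "Z \<in> carrier_mat q r" using G cB by (simp add: Z_def)
  have "A * G\<^sup>T * A = A"
  proof -
    have "(A * G * A)\<^sup>T = A * G\<^sup>T * A"
      using cA G(1) by (simp add: transpose_mult[of _ q q _ q] assoc_mult_mat[of _ q q _ q _ q] At)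
    then show ?thesis using G(2) At by simp
  qed
  then have AZ: "A * Z = B"
    unfolding Z_def A_def using G(1) by (intro gram_normal_equations[OF X]) (auto simp: B_def)
  have ZA: "Z\<^sup>T * A = C" using transpose_mult[OF cA cZ] AZ At Bt by simp
  define E where "E = Z\<^sup>T * A * Z"
  have E: "E = C * Z" "E = Z\<^sup>T * B" using cA cZ AZ by (simp_all add: E_def ZA assoc_mult_mat[of _ r q _ q _ r])
     (simp add: ZA[symmetric] assoc_mult_mat[of _ r q _ q _ r])
  \<comment> \<open>Writing \<open>B\<close> and \<open>C\<close> through \<open>A\<close> brings
    \<open>G\<close> into the combination \<open>A * G * A\<close>, where it cancels.\<close>
  have "C * G * B = Z\<^sup>T * (A * G * A) * Z"
    unfolding AZ[symmetric] ZA[symmetric] using cA cZ G(1)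
    by (simp add: assoc_mult_mat[of _ r q _ q _ q] assoc_mult_mat[of _ r q _ q _ r]
      assoc_mult_mat[of _ q q _ q _ q] assoc_mult_mat[of _ q q _ q _ r])
  then have CGB: "C * G * B = E" by (simp add: G(2) E_def)
  define z where "z x b = (\<Sum>c<q. Z $$ (c, b) * f x c)" for x b
  have zz: "(\<Sum>x\<in>X. \<xi> x * z x a * z x b) = E $$ (a, b)" if "a < r" "b < r" for a b
  proof -
    have "(\<Sum>x\<in>X. \<xi> x * z x a * z x b) = (\<Sum>c<q. \<Sum>d<q. Z $$ (c, a) * A $$ (c, d) * Z $$ (d, b))"
      by (simp add: z_def sum_weighted_linear_forms A_def)
    also have "\<dots> = (\<Sum>d<q. \<Sum>c<q. Z $$ (c, a) * A $$ (c, d) * Z $$ (d, b))" by (rule sum.swap)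
    also have "\<dots> = (\<Sum>d<q. (Z\<^sup>T * A) $$ (a, d) * Z $$ (d, b))"
      using that cZ cA by (simp add: index_mult_mat_sum[of _ r q] sum_distrib_right del: index_mult_mat)
    also have "\<dots> = E $$ (a, b)" unfolding E_def
      using that cZ cA by (subst index_mult_mat_sum[of _ r q _ r]) auto
    finally show ?thesis .
  qed
  have wz: "(\<Sum>x\<in>X. \<xi> x * f x (q + a) * z x b) = E $$ (a, b)" if "a < r" "b < r" for a b
  proof -
    have "(\<Sum>x\<in>X. \<xi> x * f x (q + a) * z x b) =
        (\<Sum>x\<in>X. \<xi> x * (\<Sum>c\<in>{a}. 1 * f x (q + c)) * (\<Sum>c<q. Z $$ (c, b) * f x c))"
      by (simp add: z_def)
    also have "\<dots> = (\<Sum>d<q. C $$ (a, d) * Z $$ (d, b))"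
      unfolding sum_weighted_linear_forms using that by (simp add: C_def)
    also have "\<dots> = E $$ (a, b)"
      using that cZ cC by (simp add: E(1) index_mult_mat_sum[of _ r q] del: index_mult_mat)
    finally show ?thesis .
  qed
  have zw: "(\<Sum>x\<in>X. \<xi> x * z x a * f x (q + b)) = E $$ (a, b)" if "a < r" "b < r" for a b
  proof -
    have "(\<Sum>x\<in>X. \<xi> x * z x a * f x (q + b)) =
        (\<Sum>x\<in>X. \<xi> x * (\<Sum>c<q. Z $$ (c, a) * f x c) * (\<Sum>c\<in>{b}. 1 * f x (q + c)))"
      by (simp add: z_def)
    also have "\<dots> = (\<Sum>c<q. Z $$ (c, a) * B $$ (c, b))"
      unfolding sum_weighted_linear_forms using that by (simp add: B_def)
    also have "\<dots> = E $$ (a, b)"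
      using that cZ cB by (simp add: E(2) index_mult_mat_sum[of _ r q] del: index_mult_mat)
    finally show ?thesis .
  qed
  have expand: "(\<Sum>x\<in>X. \<xi> x * (f x (q + a) - z x a) * (f x (q + b) - z x b)) =
      (\<Sum>x\<in>X. \<xi> x * f x (q + a) * f x (q + b)) - E $$ (a, b)" if "a < r" "b < r" for a b
  proof -
    have "(\<Sum>x\<in>X. \<xi> x * (f x (q + a) - z x a) * (f x (q + b) - z x b)) =
        (\<Sum>x\<in>X. \<xi> x * f x (q + a) * f x (q + b)) - (\<Sum>x\<in>X. \<xi> x * f x (q + a) * z x b)
        - (\<Sum>x\<in>X. \<xi> x * z x a * f x (q + b)) + (\<Sum>x\<in>X. \<xi> x * z x a * z x b)"
      by (simp add: algebra_simps sum.distrib sum_subtractf)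
    then show ?thesis using zz wz zw that by simp
  qed
  have "schur_compl q r ?M = gram X \<xi> (\<lambda>x b. f x (q + b) - z x b) r"
    unfolding S CGB
  proof (rule eq_matI)
    fix a b assume "a < dim_row (gram X \<xi> (\<lambda>x b. f x (q + b) - z x b) r)"
      "b < dim_col (gram X \<xi> (\<lambda>x b. f x (q + b) - z x b) r)"
    then have "a < r" "b < r" by auto
    then show "(D - E) $$ (a, b) = gram X \<xi> (\<lambda>x b. f x (q + b) - z x b) r $$ (a, b)"
      using cZ by (simp add: expand D_def E_def del: index_mult_mat(1))
  qed (use cZ in \<open>auto simp: E_def\<close>)
  then show ?thesis using expand zz by (intro exI[of _ z]) auto
qed

text \<open>The off-diagonal block is zero, so the correction term vanishes whichever generalized
  inverse is chosen.\<close>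

lemma schur_compl_gram_orthogonal:
  assumes "\<And>a b. a < q \<Longrightarrow> b < r \<Longrightarrow> (\<Sum>x\<in>X. \<xi> x * f x a * f x (q + b)) = 0"
  shows "schur_compl q r (gram X \<xi> f (q + r)) = gram X \<xi> (\<lambda>x b. f x (q + b)) r"
proof -
  let ?M = "gram X \<xi> f (q + r)"
  define A where "A = mat q q (\<lambda>(a, b). ?M $$ (a, b))"
  define G where "G = (SOME G. G \<in> carrier_mat q q \<and> A * G * A = A)"
  have G: "G \<in> carrier_mat q q"
    using someI_ex[OF exists_generalized_inverse[of A q]] unfolding G_def by (auto simp: A_def)
  have C: "mat r q (\<lambda>(a, b). ?M $$ (q + a, b)) = 0\<^sub>m r q"
    using assms by (auto intro!: eq_matI simp: mult_ac)
  have D: "mat r r (\<lambda>(a, b). ?M $$ (q + a, q + b)) = gram X \<xi> (\<lambda>x b. f x (q + b)) r"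
    by (auto intro!: eq_matI)
  have "schur_compl q r ?M = mat r r (\<lambda>(a, b). ?M $$ (q + a, q + b)) -
      mat r q (\<lambda>(a, b). ?M $$ (q + a, b)) * G * mat q r (\<lambda>(a, b). ?M $$ (a, q + b))"
    by (simp only: schur_compl_def Let_def A_def G_def)
  then show ?thesis unfolding C D using G by (auto intro!: eq_matI)
qed

text \<open>The sufficiency half of an equivalence theorem for D-optimality of a subvector: a bound
  on the quadratic form of \<open>R\<close> at every point of the region, averaged over
  \<open>\<xi>\<close>, bounds the trace required by \<open>det_gram_le\<close>.\<close>

lemma det_schur_compl_gram_le:
  assumes X: "finite X" "\<And>x. x \<in> X \<Longrightarrow> 0 \<le> \<xi> x" "(\<Sum>x\<in>X. \<xi> x) = 1" "\<And>x. x \<in> X \<Longrightarrow> 0 \<le> \<eta> x"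
    and orth: "\<And>a b. a < q \<Longrightarrow> b < r \<Longrightarrow> (\<Sum>x\<in>X. \<eta> x * f x a * f x (q + b)) = 0"
    and R: "R \<in> carrier_mat r r" "gram X \<eta> (\<lambda>x b. f x (q + b)) r * R = 1\<^sub>m r"
    and bound: "\<And>x. x \<in> X \<Longrightarrow> (\<Sum>a<r. \<Sum>b<r. f x (q + a) * R $$ (a, b) * f x (q + b)) \<le> real r"
  shows "det (schur_compl q r (gram X \<xi> f (q + r))) \<le> det (schur_compl q r (gram X \<eta> f (q + r)))"
proof -
  let ?w = "\<lambda>x b. f x (q + b)"
  let ?P = "gram X \<eta> ?w r"
  from schur_compl_gram[of X \<xi> q r f] X(1,2) obtain z where
    S: "schur_compl q r (gram X \<xi> f (q + r)) = gram X \<xi> (\<lambda>x b. ?w x b - z x b) r"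
    and z: "\<And>a b. a < r \<Longrightarrow> b < r \<Longrightarrow> (\<Sum>x\<in>X. \<xi> x * (?w x a - z x a) * (?w x b - z x b)) =
      (\<Sum>x\<in>X. \<xi> x * ?w x a * ?w x b) - (\<Sum>x\<in>X. \<xi> x * z x a * z x b)" by blast
  \<comment> \<open>With \<open>s = R t\<close> one has \<open>t = P s\<close>, so the form of
    \<open>R\<close> at \<open>t\<close> equals the form of the Gram matrix \<open>P\<close> at
    \<open>s\<close>, a weighted sum of squares.\<close>
  have psd: "0 \<le> (\<Sum>a<r. \<Sum>b<r. t a * R $$ (a, b) * t b)" for t
  proof -
    define s where "s a = (\<Sum>b<r. R $$ (a, b) * t b)" for a
    have Ps: "(\<Sum>b<r. ?P $$ (a, b) * s b) = t a" if "a < r" for a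
    proof -
      have "(\<Sum>b<r. ?P $$ (a, b) * s b) = (\<Sum>b<r. \<Sum>c<r. ?P $$ (a, b) * R $$ (b, c) * t c)"
        by (simp add: s_def sum_distrib_left mult.assoc)
      also have "\<dots> = (\<Sum>c<r. \<Sum>b<r. ?P $$ (a, b) * R $$ (b, c) * t c)" by (rule sum.swap)
      also have "\<dots> = (\<Sum>c<r. (?P * R) $$ (a, c) * t c)"
        using that R(1) by (simp add: index_mult_mat_sum[OF gram_carrier R(1)] sum_distrib_right
          del: index_mult_mat index_gram)
      also have "\<dots> = t a" using that
        by (simp add: R(2) if_distrib[of "\<lambda>u. u * _"] cong: if_cong)
      finally show ?thesis .
    qed
    have "(\<Sum>a<r. \<Sum>b<r. t a * R $$ (a, b) * t b) = (\<Sum>a<r. s a * t a)"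
      by (simp add: s_def sum_distrib_left sum_distrib_right mult_ac)
    also have "\<dots> = (\<Sum>a<r. \<Sum>b<r. s a * (\<Sum>x\<in>X. \<eta> x * ?w x a * ?w x b) * s b)"
    proof (rule sum.cong[OF refl])
      fix a assume "a \<in> {..<r}"
      then have "t a = (\<Sum>b<r. (\<Sum>x\<in>X. \<eta> x * ?w x a * ?w x b) * s b)" using Ps[of a] by simp
      then show "s a * t a = (\<Sum>b<r. s a * (\<Sum>x\<in>X. \<eta> x * ?w x a * ?w x b) * s b)"
        by (simp only: sum_distrib_left[of "s a" _ "{..<r}"] mult.assoc)
    qed
    also have "\<dots> = (\<Sum>x\<in>X. \<eta> x * (\<Sum>a<r. s a * ?w x a) * (\<Sum>a<r. s a * ?w x a))"
      by (rule sum_weighted_linear_forms[symmetric])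
    also have "0 \<le> \<dots>" using X(4) by (intro sum_nonneg) (auto simp: mult.assoc)
    finally show ?thesis .
  qed
  have form: "(\<Sum>x\<in>X. \<xi> x * (\<Sum>a<r. \<Sum>b<r. g x a * R $$ (a, b) * g x b)) =
      (\<Sum>a<r. \<Sum>b<r. R $$ (a, b) * (\<Sum>x\<in>X. \<xi> x * g x a * g x b))" for g
  proof -
    have "(\<Sum>x\<in>X. \<xi> x * (\<Sum>a<r. \<Sum>b<r. g x a * R $$ (a, b) * g x b)) =
        (\<Sum>x\<in>X. \<Sum>a<r. \<Sum>b<r. R $$ (a, b) * (\<xi> x * g x a * g x b))"
      by (simp add: sum_distrib_left mult_ac)
    also have "\<dots> = (\<Sum>a<r. \<Sum>x\<in>X. \<Sum>b<r. R $$ (a, b) * (\<xi> x * g x a * g x b))" by (rule sum.swap)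
    also have "\<dots> = (\<Sum>a<r. \<Sum>b<r. \<Sum>x\<in>X. R $$ (a, b) * (\<xi> x * g x a * g x b))"
      by (rule sum.cong[OF refl sum.swap])
    finally show ?thesis by (simp add: sum_distrib_left)
  qed
  have "(\<Sum>x\<in>X. \<xi> x * (\<Sum>a<r. \<Sum>b<r. (?w x a - z x a) * R $$ (a, b) * (?w x b - z x b))) =
      (\<Sum>x\<in>X. \<xi> x * (\<Sum>a<r. \<Sum>b<r. ?w x a * R $$ (a, b) * ?w x b)) -
      (\<Sum>x\<in>X. \<xi> x * (\<Sum>a<r. \<Sum>b<r. z x a * R $$ (a, b) * z x b))"
    unfolding form by (simp add: z) (simp add: right_diff_distrib sum_subtractf)
  also have "\<dots> \<le> (\<Sum>x\<in>X. \<xi> x * (\<Sum>a<r. \<Sum>b<r. ?w x a * R $$ (a, b) * ?w x b))"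
    using X(2) psd by (simp add: sum_nonneg)
  also have "\<dots> \<le> (\<Sum>x\<in>X. \<xi> x * real r)"
    using X(2) bound by (intro sum_mono mult_left_mono) auto
  also have "\<dots> = real r" by (simp add: sum_distrib_right[symmetric] X(3))
  finally have "det (gram X \<xi> (\<lambda>x b. ?w x b - z x b) r) \<le> det ?P"
    using X by (intro det_gram_le[OF X(1) _ X(1) _ R]) auto
  then show ?thesis using S schur_compl_gram_orthogonal[of q r \<eta> f X] orth by simp
qed

section \<open>Regressors indexed by lists\<close>

definition prodlists :: "nat \<Rightarrow> (nat \<Rightarrow> 'a set) \<Rightarrow> 'a list set" where
  "prodlists n W = {xs. length xs = n \<and> (\<forall>k<n. xs ! k \<in> W k)}"

lemma prodlists_0 [simp]: "prodlists 0 W = {[]}"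
  by (auto simp: prodlists_def)

lemma prodlists_Suc:
  "prodlists (Suc n) W = (\<lambda>(xs, y). xs @ [y]) ` (prodlists n W \<times> W n)"
proof (intro equalityI subsetI)
  fix xs assume xs: "xs \<in> prodlists (Suc n) W"
  then have "xs = take n xs @ [xs ! n]" "take n xs \<in> prodlists n W" "xs ! n \<in> W n"
    by (auto simp: prodlists_def take_Suc_conv_app_nth[symmetric])
  then show "xs \<in> (\<lambda>(xs, y). xs @ [y]) ` (prodlists n W \<times> W n)"
    by (intro image_eqI[of _ _ "(take n xs, xs ! n)"]) auto
qed (auto simp: prodlists_def nth_append less_Suc_eq)

lemma finite_prodlists: "(\<And>k. k < n \<Longrightarrow> finite (W k)) \<Longrightarrow> finite (prodlists n W)"
  by (induction n) (auto simp: prodlists_Suc)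

text \<open>The distributive law, by induction on the last entry. It reduces every moment and every
  quadratic form below to sums over the levels of a single attribute.\<close>

lemma sum_prod_prodlists:
  fixes u :: "nat \<Rightarrow> 'a \<Rightarrow> 'b :: comm_semiring_1"
  shows "(\<Sum>xs\<in>prodlists n W. \<Prod>k<n. u k (xs ! k)) = (\<Prod>k<n. \<Sum>y\<in>W k. u k y)"
proof (induction n)
  case (Suc n)
  have "inj_on (\<lambda>(xs, y). xs @ [y]) (prodlists n W \<times> W n)" by (auto simp: inj_on_def)
  then have "(\<Sum>xs\<in>prodlists (Suc n) W. \<Prod>k<Suc n. u k (xs ! k)) =
      (\<Sum>(xs, y)\<in>prodlists n W \<times> W n. \<Prod>k<Suc n. u k ((xs @ [y]) ! k))"
    by (simp add: prodlists_Suc sum.reindex case_prod_unfold)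
  also have "\<dots> = (\<Sum>(xs, y)\<in>prodlists n W \<times> W n. (\<Prod>k<n. u k (xs ! k)) * u n y)"
    by (rule sum.cong[OF refl]) (auto simp: prodlists_def nth_append)
  also have "\<dots> = (\<Sum>xs\<in>prodlists n W. \<Prod>k<n. u k (xs ! k)) * (\<Sum>y\<in>W n. u n y)"
    by (simp add: sum_product sum.cartesian_product)
  finally show ?case using Suc by simp
qed simp

lemma card_prodlists: "card (prodlists n W) = (\<Prod>k<n. card (W k))"
  using sum_prod_prodlists[where u = "\<lambda>_ _. 1 :: nat" and n = n and W = W] by simp

text \<open>A regressor of the model is indexed by a list \<open>a\<close> of length \<open>K\<close>: the entry \<open>a ! k\<close> is \<open>0\<close> if
  attribute \<open>k\<close> does not take part in the effect, and \<open>r \<in> {1..<v}\<close> if it contributes the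
  \<open>r\<close>-th component of \<open>f1\<close>.\<close>

definition lev :: "nat \<Rightarrow> nat \<Rightarrow> nat \<Rightarrow> real" where
  "lev v p r = (if r = 0 then 1 else if p = v then -1 else if p = r then 1 else 0)"

definition phi :: "nat \<Rightarrow> nat \<Rightarrow> nat list \<Rightarrow> nat list \<Rightarrow> real" where
  "phi v K i a = (\<Prod>k<K. lev v (i ! k) (a ! k))"

definition supp :: "nat list \<Rightarrow> nat set" where
  "supp a = {k. k < length a \<and> a ! k \<noteq> 0}"

definition effects :: "nat \<Rightarrow> nat \<Rightarrow> nat \<Rightarrow> nat list set" where
  "effects v K n = {a. length a = K \<and> (\<forall>k<K. a ! k < v) \<and> card (supp a) = n}"

lemma supp_subset: "length a = K \<Longrightarrow> supp a \<subseteq> {..<K}"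
  by (auto simp: supp_def)

lemma f1_eq_lev: "f1 v p = map (lev v p) [1..<v]"
  by (rule nth_equalityI) (auto simp: f1_def lev_def)

lemma kron_map: "kron (map f xs) (map g ys) = map (\<lambda>(x, y). f x * g y) (List.product xs ys)"
  by (induction xs) (auto simp: kron_def comp_def)

section \<open>The regression vector as an enumeration of index lists\<close>

definition idx1 :: "nat \<Rightarrow> nat \<Rightarrow> nat list list" where
  "idx1 v K = concat (map (\<lambda>k. map (\<lambda>r. (replicate K 0)[k := r]) [1..<v]) [0..<K])"

definition pairs :: "nat \<Rightarrow> (nat \<times> nat) list" where
  "pairs K = [(k, l). k \<leftarrow> [0..<K], l \<leftarrow> [Suc k..<K]]"

definition triples :: "nat \<Rightarrow> (nat \<times> nat \<times> nat) list" where
  "triples K = [(k, l, m). k \<leftarrow> [0..<K], l \<leftarrow> [Suc k..<K], m \<leftarrow> [Suc l..<K]]"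

definition idx2 :: "nat \<Rightarrow> nat \<Rightarrow> nat list list" where
  "idx2 v K = concat (map (\<lambda>(k, l). map (\<lambda>(r, s). (replicate K 0)[k := r, l := s])
     (List.product [1..<v] [1..<v])) (pairs K))"

definition idx3 :: "nat \<Rightarrow> nat \<Rightarrow> nat list list" where
  "idx3 v K = concat (map (\<lambda>(k, l, m). map (\<lambda>((r, s), t). (replicate K 0)[k := r, l := s, m := t])
     (List.product (List.product [1..<v] [1..<v]) [1..<v])) (triples K))"

lemma set_pairs: "set (pairs K) = {(k, l). k < l \<and> l < K}"
proof -
  have "(k, l) \<in> set (pairs K)" if "k < l" "l < K" for k l
    unfolding pairs_def using that by (auto intro: bexI[of _ k])
  then show ?thesis by (auto simp: pairs_def)
qed

lemma set_triples: "set (triples K) = {(k, l, m). k < l \<and> l < m \<and> m < K}"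
proof -
  have eq: "set (triples K) = (\<Union>k\<in>{0..<K}. \<Union>l\<in>{Suc k..<K}. (\<lambda>m. (k, l, m)) ` {Suc l..<K})"
    by (simp add: triples_def)
  have "(k, l, m) \<in> set (triples K)" if "k < l" "l < m" "m < K" for k l m
    unfolding eq using that by (intro UN_I[of k] UN_I[of l] imageI) auto
  then show ?thesis by (auto simp: eq)
qed

lemma phi_eq_prod_subset:
  assumes "T \<subseteq> {..<K}" "\<And>k. k < K \<Longrightarrow> k \<notin> T \<Longrightarrow> a ! k = 0"
  shows "phi v K i a = (\<Prod>k\<in>T. lev v (i ! k) (a ! k))"
  unfolding phi_def using assms by (intro prod.mono_neutral_right) (auto simp: lev_def)

lemma phi_single:
  assumes "k < K"
  shows "phi v K i ((replicate K 0)[k := r]) = lev v (i ! k) r"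
  using assms by (subst phi_eq_prod_subset[of "{k}"]) (auto simp: nth_list_update)

lemma phi_pair:
  assumes "k < l" "l < K"
  shows "phi v K i ((replicate K 0)[k := r, l := s]) = lev v (i ! k) r * lev v (i ! l) s"
  using assms by (subst phi_eq_prod_subset[of "{k, l}"]) (auto simp: nth_list_update)

lemma phi_triple:
  assumes "k < l" "l < m" "m < K"
  shows "phi v K i ((replicate K 0)[k := r, l := s, m := t]) =
    lev v (i ! k) r * lev v (i ! l) s * lev v (i ! m) t"
  using assms by (subst phi_eq_prod_subset[of "{k, l, m}"]) (auto simp: nth_list_update)

text \<open>The Kronecker product of mapped lists runs through \<open>List.product\<close> in order,
  which dictates the layout of \<open>idx2\<close> and \<open>idx3\<close>. Index entries 0
  contribute a factor 1 to \<open>phi\<close>.\<close>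

lemma fvec_eq_map_phi: "fvec v K i = map (phi v K i) (idx1 v K @ idx2 v K @ idx3 v K)"
proof -
  let ?f = "\<lambda>k. f1 v (i ! k)"
  have 1: "concat (map ?f [0..<K]) = map (phi v K i) (idx1 v K)"
    unfolding idx1_def map_concat map_map f1_eq_lev
    by (intro arg_cong[of _ _ concat] map_cong) (auto simp: phi_single)
  have "[kron (?f k) (?f l). k \<leftarrow> [0..<K], l \<leftarrow> [Suc k..<K]] = map (\<lambda>(k, l). kron (?f k) (?f l)) (pairs K)"
    by (simp add: pairs_def map_concat comp_def)
  also have "concat \<dots> = map (phi v K i) (idx2 v K)"
    unfolding idx2_def map_concat map_map f1_eq_lev kron_map
    by (intro arg_cong[of _ _ concat] map_cong) (auto simp: phi_pair set_pairs)
  finally have 2: "concat [kron (?f k) (?f l). k \<leftarrow> [0..<K], l \<leftarrow> [Suc k..<K]] = map (phi v K i) (idx2 v K)" .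
  have "[kron (kron (?f k) (?f l)) (?f m). k \<leftarrow> [0..<K], l \<leftarrow> [Suc k..<K], m \<leftarrow> [Suc l..<K]] =
      map (\<lambda>(k, l, m). kron (kron (?f k) (?f l)) (?f m)) (triples K)"
    by (simp add: triples_def map_concat comp_def)
  also have "concat \<dots> = map (phi v K i) (idx3 v K)"
    unfolding idx3_def map_concat map_map f1_eq_lev kron_map
    by (intro arg_cong[of _ _ concat] map_cong) (auto simp: phi_triple set_triples)
  finally show ?thesis unfolding fvec_def map_append 1 2 by simp
qed

text \<open>The hockey-stick identity, used to count pairs and triples by their smallest
  index.\<close>

lemma sum_choose_diff: "a \<le> K \<Longrightarrow> (\<Sum>l=a..<K. (K - Suc l) choose j) = (K - a) choose Suc j"
proof (induction rule: inc_induct)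
  case (step a)
  then have "K - a = Suc (K - Suc a)" by simp
  with step show ?case by (simp add: sum.atLeast_Suc_lessThan)
qed simp

lemma length_pairs: "length (pairs K) = K choose 2"
proof -
  have "length (pairs K) = (\<Sum>k=0..<K. (K - Suc k) choose 1)"
    by (simp add: pairs_def length_concat comp_def interv_sum_list_conv_sum_set_nat)
  then show ?thesis using sum_choose_diff[of 0 K 1] by (simp add: numeral_2_eq_2)
qed

lemma length_triples: "length (triples K) = K choose 3"
proof -
  have "length (triples K) = (\<Sum>k=0..<K. \<Sum>l=Suc k..<K. (K - Suc l) choose 1)"
    by (simp add: triples_def length_concat comp_def interv_sum_list_conv_sum_set_nat)
  also have "\<dots> = (\<Sum>k=0..<K. (K - Suc k) choose 2)"
    by (rule sum.cong[OF refl], subst sum_choose_diff) (auto simp: numeral_2_eq_2)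
  finally show ?thesis using sum_choose_diff[of 0 K 2] by (simp add: numeral_3_eq_3 numeral_2_eq_2)
qed

lemma length_idx12: "length (idx1 v K @ idx2 v K) = p12 v K"
proof -
  have "length (idx1 v K) = K * (v - 1)"
    by (simp add: idx1_def length_concat comp_def sum_list_triv)
  moreover have "length (idx2 v K) = (\<Sum>x\<leftarrow>pairs K. (v - 1)\<^sup>2)"
    unfolding idx2_def length_concat map_map
    by (intro arg_cong[of _ _ sum_list] map_cong) (auto simp: length_product power2_eq_square)
  ultimately show ?thesis by (simp add: p12_def length_pairs sum_list_triv)
qed

lemma length_idx3: "length (idx3 v K) = p3 v K"
proof -
  have "length (idx3 v K) = (\<Sum>x\<leftarrow>triples K. (v - 1) ^ 3)"
    unfolding idx3_def length_concat map_map
    by (intro arg_cong[of _ _ sum_list] map_cong) (auto simp: length_product power3_eq_cube)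
  then show ?thesis by (simp add: p3_def length_triples sum_list_triv)
qed

lemma set_idx12_subset: "set (idx1 v K @ idx2 v K) \<subseteq> effects v K 1 \<union> effects v K 2"
proof -
  have "supp ((replicate K 0)[k := r]) = {k}" if "k < K" "1 \<le> r" for k r
    using that by (auto simp: supp_def nth_list_update)
  then have 1: "set (idx1 v K) \<subseteq> effects v K 1"
    by (auto simp: idx1_def effects_def nth_list_update)
  have "supp ((replicate K 0)[k := r, l := s]) = {k, l}" if "k < l" "l < K" "1 \<le> r" "1 \<le> s" for k l r s
    using that by (auto simp: supp_def nth_list_update)
  then have 2: "set (idx2 v K) \<subseteq> effects v K 2"
    by (auto simp: idx2_def effects_def nth_list_update set_pairs)
  show ?thesis using 1 2 by auto
qed

lemma set_idx3: "set (idx3 v K) = effects v K 3"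
proof (intro equalityI subsetI)
  have "supp ((replicate K 0)[k := r, l := s, m := t]) = {k, l, m}"
    if "k < l" "l < m" "m < K" "1 \<le> r" "1 \<le> s" "1 \<le> t" for k l m r s t
    using that by (auto simp: supp_def nth_list_update)
  then show "a \<in> effects v K 3" if "a \<in> set (idx3 v K)" for a
    using that by (auto simp: idx3_def effects_def nth_list_update set_triples)
next
  fix a assume a: "a \<in> effects v K 3"
  \<comment> \<open>Sorting the support recovers the increasing triple of attributes under which
    \<open>a\<close> is enumerated.\<close>
  define xs where "xs = sorted_list_of_set (supp a)"
  have "finite (supp a)" by (simp add: supp_def)
  then have xs: "set xs = supp a" "sorted_wrt (<) xs" "length xs = 3"
    using a by (auto simp: xs_def effects_def)
  then obtain k l m where klm: "xs = [k, l, m]"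
    by (metis (no_types, opaque_lifting) length_0_conv length_Suc_conv numeral_3_eq_3)
  then have s: "supp a = {k, l, m}" "k < l" "l < m" using xs by auto
  then have m: "m < K" "a ! k \<noteq> 0" "a ! l \<noteq> 0" "a ! m \<noteq> 0" using a by (auto simp: supp_def effects_def)
  have "a = (replicate K 0)[k := a ! k, l := a ! l, m := a ! m]"
    using a s m by (intro nth_equalityI) (auto simp: effects_def nth_list_update supp_def)
  moreover have "a ! k < v" "a ! l < v" "a ! m < v" using a s m by (auto simp: effects_def)
  ultimately have "a \<in> (\<lambda>((r, s), t). (replicate K 0)[k := r, l := s, m := t]) `
      set (List.product (List.product [1..<v] [1..<v]) [1..<v])"
    using m by (intro image_eqI[of _ _ "((a ! k, a ! l), a ! m)"]) auto
  moreover have "(k, l, m) \<in> set (triples K)" using s m by (simp add: set_triples)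
  ultimately show "a \<in> set (idx3 v K)"
    unfolding idx3_def set_concat set_map by (intro UN_I[OF imageI, of "(k, l, m)"]) auto
qed

section \<open>Effects grouped by their support\<close>

text \<open>For a fixed support the index entries vary independently, so these effects form a
  product set to which \<open>sum_prod_prodlists\<close> applies.\<close>

definition effects_on :: "nat \<Rightarrow> nat \<Rightarrow> nat set \<Rightarrow> nat list set" where
  "effects_on v K T = prodlists K (\<lambda>k. if k \<in> T then {1..<v} else {0})"

lemma finite_effects_on [simp]: "finite (effects_on v K T)"
  by (auto simp: effects_on_def intro: finite_prodlists)

lemma finite_effects [simp]: "finite (effects v K n)"
proof -
  have "effects v K n \<subseteq> prodlists K (\<lambda>_. {..<v})" by (auto simp: effects_def prodlists_def)
  then show ?thesis by (rule finite_subset) (auto intro: finite_prodlists)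
qed

lemma effects_with_supp:
  assumes "0 < v" "T \<subseteq> {..<K}" "card T = n"
  shows "{a \<in> effects v K n. supp a = T} = effects_on v K T"
proof (intro equalityI subsetI)
  fix a assume "a \<in> {a \<in> effects v K n. supp a = T}"
  then show "a \<in> effects_on v K T"
    by (auto simp: effects_def effects_on_def prodlists_def supp_def)
next
  fix a assume a: "a \<in> effects_on v K T"
  then have len: "length a = K" and nth: "\<And>k. k < K \<Longrightarrow> a ! k \<in> (if k \<in> T then {1..<v} else {0})"
    by (auto simp: effects_on_def prodlists_def)
  have "a ! k < v" "a ! k \<noteq> 0 \<longleftrightarrow> k \<in> T" if "k < K" for k
    using nth[OF that] assms(1) by (auto split: if_splits)
  moreover from this have "supp a = T" using assms(2) len by (auto simp: supp_def)
  ultimately show "a \<in> {a \<in> effects v K n. supp a = T}"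
    using assms(3) len by (simp add: effects_def)
qed

lemma sum_effects:
  assumes "0 < v"
  shows "(\<Sum>a\<in>effects v K n. h a) = (\<Sum>T | T \<subseteq> {..<K} \<and> card T = n. \<Sum>a\<in>effects_on v K T. h a)"
proof -
  have "(\<Sum>a\<in>effects v K n. h a) =
      (\<Sum>T | T \<subseteq> {..<K} \<and> card T = n. \<Sum>a | a \<in> effects v K n \<and> supp a = T. h a)"
    by (rule sum.group[symmetric]) (simp_all, auto simp: effects_def supp_def)
  then show ?thesis using effects_with_supp[OF assms] by simp
qed

lemma card_effects_3:
  assumes "0 < v"
  shows "card (effects v K 3) = p3 v K"
proof -
  have "card (effects v K 3) = (\<Sum>T | T \<subseteq> {..<K} \<and> card T = 3. card (effects_on v K T))"
    using sum_effects[OF assms, where K = K and n = 3 and h = "\<lambda>_. 1 :: nat"] by simp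
  also have "\<dots> = (\<Sum>T | T \<subseteq> {..<K} \<and> card T = 3. (v - 1) ^ 3)"
  proof (rule sum.cong[OF refl])
    fix T assume "T \<in> {T. T \<subseteq> {..<K} \<and> card T = 3}"
    then have T: "T \<subseteq> {..<K}" "card T = 3" by auto
    have "card (effects_on v K T) = (\<Prod>k<K. if k \<in> T then v - 1 else 1)"
      unfolding effects_on_def card_prodlists by (intro prod.cong) auto
    also have "\<dots> = (\<Prod>k\<in>T. v - 1)" using T by (intro prod.mono_neutral_cong_right) auto
    finally show "card (effects_on v K T) = (v - 1) ^ 3" using T by simp
  qed
  also have "\<dots> = p3 v K" using n_subsets[of "{..<K}" 3] by (simp add: p3_def)
  finally show ?thesis .
qed

text \<open>The list is exactly as long as its set is large, by the two counts of second-order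
  regressors, so nothing is repeated.\<close>

lemma distinct_idx3: "0 < v \<Longrightarrow> distinct (idx3 v K)"
  by (rule card_distinct) (simp add: set_idx3 card_effects_3 length_idx3)

lemma sum_idx3:
  assumes "0 < v"
  shows "(\<Sum>b<p3 v K. h (idx3 v K ! b)) = (\<Sum>a\<in>effects v K 3. h a)"
proof -
  have "(\<Sum>a\<in>effects v K 3. h a) = sum_list (map h (idx3 v K))"
    using distinct_idx3[OF assms] by (simp add: set_idx3[symmetric] sum.distinct_set_conv_list)
  then show ?thesis by (simp add: sum_list_sum_nth length_idx3 lessThan_atLeast0)
qed

section \<open>Pairs of fixed depth\<close>

text \<open>\<open>level_pairs v inA inD\<close> is the set of level pairs at one attribute, according to whether the
  attribute belongs to the set \<open>A\<close> of shown attributes and to the set \<open>D\<close> of differing ones.\<close>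

definition level_pairs :: "nat \<Rightarrow> bool \<Rightarrow> bool \<Rightarrow> (nat \<times> nat) set" where
  "level_pairs v inA inD =
    (if inD then {1..v} \<times> {1..v} - Id else if inA then Id_on {1..v} else {(0, 0)})"

definition depth_sets :: "nat \<Rightarrow> nat \<Rightarrow> nat \<Rightarrow> (nat set \<times> nat set) set" where
  "depth_sets K S d = {(A, D). A \<subseteq> {..<K} \<and> card A = S \<and> D \<subseteq> A \<and> card D = d}"

definition diff_set :: "nat list \<times> nat list \<Rightarrow> nat set" where
  "diff_set x = {k. k < length (fst x) \<and> fst x ! k \<noteq> snd x ! k}"

lemma level_pairs_subset: "level_pairs v inA inD \<subseteq> {0..v} \<times> {0..v}"
  by (auto simp: level_pairs_def)

lemma finite_level_pairs [simp]: "finite (level_pairs v inA inD)"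
  by (rule finite_subset[OF level_pairs_subset]) simp

lemma finite_depth_sets [simp]: "finite (depth_sets K S d)"
proof -
  have "depth_sets K S d \<subseteq> Pow {..<K} \<times> Pow {..<K}" by (auto simp: depth_sets_def)
  then show ?thesis by (rule finite_subset) simp
qed

text \<open>The sum over distinct levels is the sum over the full square minus the diagonal.\<close>

lemma sum_level_pairs:
  fixes g h :: "nat \<Rightarrow> 'a :: comm_ring_1"
  shows "(\<Sum>(p, q)\<in>level_pairs v inA inD. g p * h q) =
    (if inD then (\<Sum>p=1..v. g p) * (\<Sum>p=1..v. h p) - (\<Sum>p=1..v. g p * h p)
     else if inA then \<Sum>p=1..v. g p * h p else g 0 * h 0)"
proof -
  have Id: "(\<Sum>(p, q)\<in>Id_on {1..v}. g p * h q) = (\<Sum>p=1..v. g p * h p)"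
  proof -
    have "Id_on {1..v} = (\<lambda>p. (p, p)) ` {1..v}" by auto
    then show ?thesis by (simp add: sum.reindex inj_on_def)
  qed
  have "(\<Sum>(p, q)\<in>{1..v} \<times> {1..v} - Id. g p * h q) =
      (\<Sum>(p, q)\<in>{1..v} \<times> {1..v} - Id_on {1..v}. g p * h q)"
    by (rule sum.cong) auto
  also have "\<dots> = (\<Sum>(p, q)\<in>{1..v} \<times> {1..v}. g p * h q) - (\<Sum>(p, q)\<in>Id_on {1..v}. g p * h q)"
    by (rule sum_diff) auto
  also have "(\<Sum>(p, q)\<in>{1..v} \<times> {1..v}. g p * h q) = (\<Sum>p=1..v. g p) * (\<Sum>p=1..v. h p)"
    by (simp add: sum_product sum.cartesian_product)
  finally show ?thesis using Id by (simp add: level_pairs_def)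
qed

text \<open>The set \<open>A\<close> in the definition of the region is forced to be the support of
  the first profile. Once it is named, membership becomes one condition per attribute.\<close>

lemma design_region_iff:
  "x \<in> design_region v K S \<longleftrightarrow> length (fst x) = K \<and> length (snd x) = K \<and> card (supp (fst x)) = S \<and>
    (\<forall>k<K. (fst x ! k, snd x ! k) \<in> level_pairs v (k \<in> supp (fst x)) (k \<in> diff_set x))"
proof -
  obtain i j where x: "x = (i, j)" by (cases x)
  have "(\<exists>A. A \<subseteq> {0..<K} \<and> card A = S \<and> (\<forall>k\<in>A. i ! k \<in> {1..v} \<and> j ! k \<in> {1..v}) \<and>
      (\<forall>k<K. k \<notin> A \<longrightarrow> i ! k = 0 \<and> j ! k = 0)) \<longleftrightarrow>
    card (supp i) = S \<and> (\<forall>k<K. (i ! k, j ! k) \<in> level_pairs v (k \<in> supp i) (k \<in> diff_set x))"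
    (is "?L \<longleftrightarrow> ?R") if len: "length i = K" "length j = K"
  proof
    assume ?L
    then obtain A where A: "A \<subseteq> {0..<K}" "card A = S" "\<forall>k\<in>A. i ! k \<in> {1..v} \<and> j ! k \<in> {1..v}"
      "\<forall>k<K. k \<notin> A \<longrightarrow> i ! k = 0 \<and> j ! k = 0" by blast
    have iA: "supp i = A" 
    proof (intro equalityI subsetI)
      show "k \<in> A" if "k \<in> supp i" for k using that A(4) len by (auto simp: supp_def)
      show "k \<in> supp i" if "k \<in> A" for k using that A(1,3) len by (force simp: supp_def)
    qed
    have "(i ! k, j ! k) \<in> level_pairs v (k \<in> A) (k \<in> diff_set x)" if "k < K" for k
      using that A len by (cases "k \<in> A") (auto simp: level_pairs_def diff_set_def x)
    then show ?R using iA A by simp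
  next
    assume R: ?R
    have "i ! k \<in> {1..v} \<and> j ! k \<in> {1..v}" if "k \<in> supp i" for k
    proof -
      have "k < K" using that len by (simp add: supp_def)
      then have "(i ! k, j ! k) \<in> level_pairs v True (k \<in> diff_set x)" using R that by auto
      then show ?thesis by (auto simp: level_pairs_def split: if_splits)
    qed
    moreover have "i ! k = 0 \<and> j ! k = 0" if "k < K" "k \<notin> supp i" for k
    proof -
      have "i ! k = 0" using that len by (simp add: supp_def)
      moreover have "(i ! k, j ! k) \<in> level_pairs v False (k \<in> diff_set x)" using R that by auto
      ultimately show ?thesis by (auto simp: level_pairs_def split: if_splits)
    qed
    moreover have "supp i \<subseteq> {0..<K}" using len by (auto simp: supp_def)
    ultimately show ?L using R by (intro exI[of _ "supp i"]) auto
  qed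
  then show ?thesis by (auto simp: design_region_def x)
qed

lemma diff_set_subset_supp:
  assumes "x \<in> design_region v K S"
  shows "diff_set x \<subseteq> supp (fst x)"
proof
  fix k assume k: "k \<in> diff_set x"
  then have "k < K" "(fst x ! k, snd x ! k) \<in> level_pairs v (k \<in> supp (fst x)) True"
    using assms by (auto simp: design_region_iff diff_set_def)
  then show "k \<in> supp (fst x)" using assms by (auto simp: level_pairs_def supp_def design_region_iff)
qed

lemma supp_level_pairs:
  assumes "(A, D) \<in> depth_sets K S d" "w \<in> prodlists K (\<lambda>k. level_pairs v (k \<in> A) (k \<in> D))"
  shows "supp (map fst w) = A" "diff_set (map fst w, map snd w) = D"
proof -
  have AD: "A \<subseteq> {..<K}" "D \<subseteq> A" using assms(1) by (auto simp: depth_sets_def)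
  have w: "w ! k \<in> level_pairs v (k \<in> A) (k \<in> D)" if "k < K" for k
    using assms(2) that by (auto simp: prodlists_def)
  have len: "length w = K" using assms(2) by (simp add: prodlists_def)
  have 1: "fst (w ! k) \<noteq> 0 \<longleftrightarrow> k \<in> A" "fst (w ! k) \<noteq> snd (w ! k) \<longleftrightarrow> k \<in> D" if "k < K" for k
    using w[OF that] AD by (auto simp: level_pairs_def split: if_splits)
  show "supp (map fst w) = A" using 1(1) AD len by (auto simp: supp_def subset_iff)
  show "diff_set (map fst w, map snd w) = D" using 1(2) AD(1)[THEN subsetD] AD(2)[THEN subsetD] len
    by (fastforce simp: diff_set_def)
qed

text \<open>After \<open>A\<close> and \<open>D\<close> are fixed, the level pairs at different
  attributes are chosen independently; zipping the two profiles turns the fibre into a product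
  set.\<close>

lemma design_region_d_fibre:
  assumes AD: "(A, D) \<in> depth_sets K S d"
  shows "{x \<in> design_region_d v K S d. (supp (fst x), diff_set x) = (A, D)} =
    (\<lambda>w. (map fst w, map snd w)) ` prodlists K (\<lambda>k. level_pairs v (k \<in> A) (k \<in> D))"
proof (intro equalityI subsetI)
  fix x assume x: "x \<in> {x \<in> design_region_d v K S d. (supp (fst x), diff_set x) = (A, D)}"
  then have r: "x \<in> design_region v K S" "supp (fst x) = A" "diff_set x = D"
    by (auto simp: design_region_d_def)
  define w where "w = zip (fst x) (snd x)"
  have "w \<in> prodlists K (\<lambda>k. level_pairs v (k \<in> A) (k \<in> D))"
    using r(1)[unfolded design_region_iff r(2,3)] by (simp add: w_def prodlists_def)
  moreover have "x = (map fst w, map snd w)"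
    using r(1)[unfolded design_region_iff] by (simp add: w_def)
  ultimately show "x \<in> (\<lambda>w. (map fst w, map snd w)) ` prodlists K (\<lambda>k. level_pairs v (k \<in> A) (k \<in> D))"
    by (rule image_eqI[rotated])
next
  fix x assume "x \<in> (\<lambda>w. (map fst w, map snd w)) ` prodlists K (\<lambda>k. level_pairs v (k \<in> A) (k \<in> D))"
  then obtain w where w: "w \<in> prodlists K (\<lambda>k. level_pairs v (k \<in> A) (k \<in> D))"
    and x: "x = (map fst w, map snd w)" by auto
  note s = supp_level_pairs[OF AD w]
  have len: "length w = K" using w by (simp add: prodlists_def)
  have "x \<in> design_region v K S"
    using w AD s len by (simp add: design_region_iff x prodlists_def depth_sets_def)
  moreover have "card {k. k < K \<and> fst x ! k \<noteq> snd x ! k} = d"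
    using s(2) AD len by (simp add: x diff_set_def depth_sets_def)
  ultimately show "x \<in> {x \<in> design_region_d v K S d. (supp (fst x), diff_set x) = (A, D)}"
    using s by (simp add: design_region_d_def x)
qed

lemma finite_design_region [simp]: "finite (design_region v K S)"
proof -
  have "design_region v K S \<subseteq> {xs. set xs \<subseteq> {0..v} \<and> length xs = K} \<times> {xs. set xs \<subseteq> {0..v} \<and> length xs = K}"
  proof
    fix x assume "x \<in> design_region v K S"
    then have l: "length (fst x) = K" "length (snd x) = K" and
      "\<forall>k<K. (fst x ! k, snd x ! k) \<in> level_pairs v (k \<in> supp (fst x)) (k \<in> diff_set x)"
      by (auto simp: design_region_iff)
    then have "fst x ! k \<in> {0..v} \<and> snd x ! k \<in> {0..v}" if "k < K" for k
      using that level_pairs_subset[of v "k \<in> supp (fst x)" "k \<in> diff_set x"] by blast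
    then have "set (fst x) \<subseteq> {0..v}" "set (snd x) \<subseteq> {0..v}"
      using l by (auto simp: in_set_conv_nth)
    then show "x \<in> {xs. set xs \<subseteq> {0..v} \<and> length xs = K} \<times> {xs. set xs \<subseteq> {0..v} \<and> length xs = K}"
      using l by (auto simp: mem_Times_iff)
  qed
  then show ?thesis by (rule finite_subset) (simp add: finite_lists_length_eq)
qed

lemma design_region_d_subset: "design_region_d v K S d \<subseteq> design_region v K S"
  by (auto simp: design_region_d_def)

lemma design_region_dD:
  assumes "x \<in> design_region_d v K S d"
  shows "x \<in> design_region v K S" "card (diff_set x) = d"
  using assms by (auto simp: design_region_d_def diff_set_def design_region_iff)

lemma finite_design_region_d [simp]: "finite (design_region_d v K S d)"
  by (rule finite_subset[OF design_region_d_subset finite_design_region])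

lemma sum_design_region_d:
  "(\<Sum>x\<in>design_region_d v K S d. h x) =
    (\<Sum>(A, D)\<in>depth_sets K S d. \<Sum>w\<in>prodlists K (\<lambda>k. level_pairs v (k \<in> A) (k \<in> D)).
      h (map fst w, map snd w))"
proof -
  have "(\<Sum>x\<in>design_region_d v K S d. h x) =
      (\<Sum>y\<in>depth_sets K S d. \<Sum>x | x \<in> design_region_d v K S d \<and> (supp (fst x), diff_set x) = y. h x)"
  proof (rule sum.group[symmetric])
    show "(\<lambda>x. (supp (fst x), diff_set x)) ` design_region_d v K S d \<subseteq> depth_sets K S d"
    proof
      fix y assume "y \<in> (\<lambda>x. (supp (fst x), diff_set x)) ` design_region_d v K S d"
      then obtain x where x: "x \<in> design_region_d v K S d" "y = (supp (fst x), diff_set x)" by auto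
      note xx = design_region_dD[OF x(1)]
      show "y \<in> depth_sets K S d"
        using xx diff_set_subset_supp[OF xx(1)] supp_subset[of "fst x" K] x(2)
        by (auto simp: depth_sets_def design_region_iff)
    qed
  qed simp_all
  also have "\<dots> = (\<Sum>(A, D)\<in>depth_sets K S d. \<Sum>w\<in>prodlists K (\<lambda>k. level_pairs v (k \<in> A) (k \<in> D)).
      h (map fst w, map snd w))"
  proof (rule sum.cong[OF refl], clarify)
    fix A D assume AD: "(A, D) \<in> depth_sets K S d"
    have inj: "inj_on (\<lambda>w. (map fst w, map snd w)) W" for W :: "(nat \<times> nat) list set"
      by (auto simp: inj_on_def) (metis zip_map_fst_snd)
    show "(\<Sum>x | x \<in> design_region_d v K S d \<and> (supp (fst x), diff_set x) = (A, D). h x) =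
        (\<Sum>w\<in>prodlists K (\<lambda>k. level_pairs v (k \<in> A) (k \<in> D)). h (map fst w, map snd w))"
      unfolding design_region_d_fibre[OF AD] by (simp add: sum.reindex[OF inj])
  qed
  finally show ?thesis .
qed

lemma design_region_d_nonempty:
  assumes "2 \<le> v" "d \<le> S" "S \<le> K"
  shows "design_region_d v K S d \<noteq> {}"
proof -
  have AD: "({..<S}, {..<d}) \<in> depth_sets K S d" using assms by (auto simp: depth_sets_def)
  define w where "w = map (\<lambda>k. if k < d then (1 :: nat, 2) else if k < S then (1, 1) else (0, 0 :: nat)) [0..<K]"
  have "w \<in> prodlists K (\<lambda>k. level_pairs v (k \<in> {..<S}) (k \<in> {..<d}))"
    using assms by (auto simp: w_def prodlists_def level_pairs_def)
  then have "(map fst w, map snd w) \<in> design_region_d v K S d"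
    using design_region_d_fibre[OF AD, of v] by auto
  then show ?thesis by auto
qed

section \<open>Second moments of the uniform design\<close>

text \<open>Summing products of components of \<open>f1\<close> over all levels gives the matrix \<open>I + J\<close>, with inverse
  \<open>I - J / v\<close>. The index \<open>0\<close> adjoins the constant function, orthogonal to these components.\<close>

definition cov1 :: "nat \<Rightarrow> nat \<Rightarrow> real" where
  "cov1 r s = (if r = 0 \<and> s = 0 then 1 else if r = 0 \<or> s = 0 then 0 else if r = s then 2 else 1)"

definition prec1 :: "nat \<Rightarrow> nat \<Rightarrow> nat \<Rightarrow> real" where
  "prec1 v r s = (if r = 0 \<and> s = 0 then 1 else if r = 0 \<or> s = 0 then 0
     else (if r = s then 1 else 0) - 1 / real v)"

definition cov :: "nat \<Rightarrow> nat list \<Rightarrow> nat list \<Rightarrow> real" where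
  "cov K a b = (\<Prod>k<K. cov1 (a ! k) (b ! k))"

definition prec :: "nat \<Rightarrow> nat \<Rightarrow> nat list \<Rightarrow> nat list \<Rightarrow> real" where
  "prec v K a b = (\<Prod>k<K. prec1 v (a ! k) (b ! k))"

text \<open>The factor in front of \<open>cov1\<close> when both components are taken at the same
  profile. It depends on the effect only through whether the attribute takes part. Each level occurs
  in \<open>v - 1\<close> ordered pairs of distinct levels, and a hidden attribute gives 0 because
  \<open>f1\<close> vanishes at level 0.\<close>

definition same_moment :: "nat \<Rightarrow> bool \<Rightarrow> bool \<Rightarrow> bool \<Rightarrow> real" where
  "same_moment v inT inA inD =
    (if inT then if inD then real v - 1 else if inA then 1 else 0
     else if inD then real v * (real v - 1) else if inA then real v else 1)"

text \<open>The analogue for components at opposite profiles. The value -1 arises because the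
  components of \<open>f1\<close> sum to zero over the levels, leaving only the subtracted
  diagonal.\<close>

definition cross_moment :: "nat \<Rightarrow> bool \<Rightarrow> bool \<Rightarrow> bool \<Rightarrow> real" where
  "cross_moment v inT inA inD =
    (if inT then if inD then -1 else if inA then 1 else 0
     else if inD then real v * (real v - 1) else if inA then real v else 1)"

lemma sum_lev:
  assumes "1 \<le> r" "r < v"
  shows "(\<Sum>p=1..v. lev v p r) = 0"
proof -
  have "{1..v} = insert v {1..<v}" using assms by auto
  moreover have "(\<Sum>p\<in>{1..<v}. lev v p r) = (\<Sum>p\<in>{1..<v}. if p = r then 1 else 0)"
    using assms by (intro sum.cong) (auto simp: lev_def)
  ultimately show ?thesis using assms by (simp add: lev_def)
qed

lemma sum_lev_mult_lev:
  assumes "1 \<le> r" "r < v" "1 \<le> s" "s < v"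
  shows "(\<Sum>p=1..v. lev v p r * lev v p s) = cov1 r s"
proof -
  have "{1..v} = insert v {1..<v}" using assms by auto
  moreover have "(\<Sum>p\<in>{1..<v}. lev v p r * lev v p s) = (\<Sum>p\<in>{1..<v}. if p = r then if r = s then 1 else 0 else 0)"
    using assms by (intro sum.cong) (auto simp: lev_def)
  ultimately show ?thesis using assms by (simp add: lev_def cov1_def)
qed

lemma lev_zero: "0 < v \<Longrightarrow> lev v 0 r = (if r = 0 then 1 else 0)"
  by (simp add: lev_def)

lemma lev_index_zero [simp]: "lev v p 0 = 1"
  by (simp add: lev_def)

lemma level_pairs_moments:
  assumes "2 \<le> v" "r < v" "s < v"
  shows "(\<Sum>(p, q)\<in>level_pairs v inA inD. lev v p r * lev v p s) = same_moment v (r \<noteq> 0) inA inD * cov1 r s"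
    and "(\<Sum>(p, q)\<in>level_pairs v inA inD. lev v q r * lev v q s) = same_moment v (r \<noteq> 0) inA inD * cov1 r s"
    and "(\<Sum>(p, q)\<in>level_pairs v inA inD. lev v p r * lev v q s) = cross_moment v (r \<noteq> 0) inA inD * cov1 r s"
proof -
  consider "r = 0" "s = 0" | "r = 0" "1 \<le> s" | "1 \<le> r" "s = 0" | "1 \<le> r" "1 \<le> s" by linarith
  \<comment> \<open>\<open>cov1 0 0\<close> is normalised to 1, so the sum of the constant function
    over the levels has to be separated; \<open>same_moment\<close> and \<open>cross_moment\<close>
    absorb it.\<close>
  then have *: "(\<Sum>p=1..v. lev v p r * lev v p s) = (if r = 0 \<and> s = 0 then real v else cov1 r s)"
    using assms by cases (auto simp: sum_lev sum_lev_mult_lev cov1_def simp del: One_nat_def)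
  \<comment> \<open>The factor 1 plays the function of \<open>q\<close>, so that the sum has the
    shape of \<open>sum_level_pairs\<close>.\<close>
  have "(\<Sum>(p, q)\<in>level_pairs v inA inD. lev v p r * lev v p s * 1) = same_moment v (r \<noteq> 0) inA inD * cov1 r s"
    unfolding sum_level_pairs using * assms
    by (auto simp: lev_zero same_moment_def cov1_def algebra_simps simp del: One_nat_def)
  then show "(\<Sum>(p, q)\<in>level_pairs v inA inD. lev v p r * lev v p s) = same_moment v (r \<noteq> 0) inA inD * cov1 r s"
    by simp
  have "(\<Sum>(p, q)\<in>level_pairs v inA inD. 1 * (lev v q r * lev v q s)) = same_moment v (r \<noteq> 0) inA inD * cov1 r s"
    unfolding sum_level_pairs using * assms
    by (auto simp: lev_zero same_moment_def cov1_def algebra_simps simp del: One_nat_def)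
  then show "(\<Sum>(p, q)\<in>level_pairs v inA inD. lev v q r * lev v q s) = same_moment v (r \<noteq> 0) inA inD * cov1 r s"
    by simp
  show "(\<Sum>(p, q)\<in>level_pairs v inA inD. lev v p r * lev v q s) = cross_moment v (r \<noteq> 0) inA inD * cov1 r s"
    unfolding sum_level_pairs using * assms sum_lev[of r v] sum_lev[of s v]
    by (auto simp: lev_zero cross_moment_def cov1_def algebra_simps simp del: One_nat_def)
qed

section \<open>Second moments of differences of regressors\<close>

definition phi_diff :: "nat \<Rightarrow> nat \<Rightarrow> nat list \<times> nat list \<Rightarrow> nat list \<Rightarrow> real" where
  "phi_diff v K x a = phi v K (fst x) a - phi v K (snd x) a"

text \<open>The scalar multiplying \<open>cov\<close> in the unnormalised second moments of effects
  with support \<open>T\<close>. Same-profile and opposite-profile terms each occur twice, whence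
  the 2.\<close>

definition mass :: "nat \<Rightarrow> nat \<Rightarrow> nat \<Rightarrow> nat \<Rightarrow> nat set \<Rightarrow> real" where
  "mass v K S d T = (\<Sum>(A, D)\<in>depth_sets K S d.
     2 * ((\<Prod>k<K. same_moment v (k \<in> T) (k \<in> A) (k \<in> D)) -
          (\<Prod>k<K. cross_moment v (k \<in> T) (k \<in> A) (k \<in> D))))"

text \<open>Expanding the product of differences gives four sums. For fixed \<open>A\<close> and
  \<open>D\<close> each factors over the attributes, and every factor is a multiple of
  \<open>cov1\<close>.\<close>

lemma sum_phi_diff:
  assumes v: "2 \<le> v" and a: "length a = K" "\<And>k. k < K \<Longrightarrow> a ! k < v"
    and b: "length b = K" "\<And>k. k < K \<Longrightarrow> b ! k < v"
  shows "(\<Sum>x\<in>design_region_d v K S d. phi_diff v K x a * phi_diff v K x b) =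
    mass v K S d (supp a) * cov K a b"
proof -
  have "(\<Sum>w\<in>prodlists K (\<lambda>k. level_pairs v (k \<in> A) (k \<in> D)).
      phi_diff v K (map fst w, map snd w) a * phi_diff v K (map fst w, map snd w) b) =
    2 * ((\<Prod>k<K. same_moment v (k \<in> supp a) (k \<in> A) (k \<in> D)) -
         (\<Prod>k<K. cross_moment v (k \<in> supp a) (k \<in> A) (k \<in> D))) * cov K a b" for A D
  proof -
    let ?W = "\<lambda>k. level_pairs v (k \<in> A) (k \<in> D)"
    have fact: "(\<Sum>w\<in>prodlists K ?W. phi v K (map g w) a' * phi v K (map h w) b') =
        (\<Prod>k<K. \<Sum>y\<in>?W k. lev v (g y) (a' ! k) * lev v (h y) (b' ! k))" for g h a' b'
    proof -
      have "(\<Sum>w\<in>prodlists K ?W. phi v K (map g w) a' * phi v K (map h w) b') =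
        (\<Sum>w\<in>prodlists K ?W. \<Prod>k<K. lev v (g (w ! k)) (a' ! k) * lev v (h (w ! k)) (b' ! k))"
        by (rule sum.cong[OF refl]) (simp add: phi_def prod.distrib prodlists_def)
      then show ?thesis
        using sum_prod_prodlists[where u = "\<lambda>k y. lev v (g y) (a' ! k) * lev v (h y) (b' ! k)"] by simp
    qed
    have s: "k \<in> supp a \<longleftrightarrow> a ! k \<noteq> 0" if "k < K" for k using that a by (simp add: supp_def)
    have same: "(\<Prod>k<K. \<Sum>y\<in>?W k. lev v (fst y) (a ! k) * lev v (fst y) (b ! k)) =
        (\<Prod>k<K. same_moment v (k \<in> supp a) (k \<in> A) (k \<in> D)) * cov K a b"
      "(\<Prod>k<K. \<Sum>y\<in>?W k. lev v (snd y) (a ! k) * lev v (snd y) (b ! k)) =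
        (\<Prod>k<K. same_moment v (k \<in> supp a) (k \<in> A) (k \<in> D)) * cov K a b"
      unfolding cov_def prod.distrib[symmetric]
      using level_pairs_moments(1,2)[OF v a(2) b(2)] s by (auto simp: case_prod_unfold intro!: prod.cong)
    have cross1: "(\<Prod>k<K. \<Sum>y\<in>?W k. lev v (fst y) (a ! k) * lev v (snd y) (b ! k)) =
        (\<Prod>k<K. cross_moment v (k \<in> supp a) (k \<in> A) (k \<in> D)) * cov K a b"
      unfolding cov_def prod.distrib[symmetric]
      using level_pairs_moments(3)[OF v a(2) b(2)] s by (auto simp: case_prod_unfold intro!: prod.cong)
    \<comment> \<open>The moment lemma is applied with \<open>a\<close> and \<open>b\<close>
      exchanged. Its flag then refers to \<open>b\<close>, but where the flags of \<open>a\<close>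
      and \<open>b\<close> differ, \<open>cov1\<close> is 0.\<close>
    have cross2: "(\<Prod>k<K. \<Sum>y\<in>?W k. lev v (snd y) (a ! k) * lev v (fst y) (b ! k)) =
        (\<Prod>k<K. cross_moment v (k \<in> supp a) (k \<in> A) (k \<in> D)) * cov K a b"
      unfolding cov_def prod.distrib[symmetric]
    proof (rule prod.cong[OF refl])
      fix k assume "k \<in> {..<K}"
      then have k: "k < K" by simp
      have "(\<Sum>y\<in>?W k. lev v (snd y) (a ! k) * lev v (fst y) (b ! k)) =
          cross_moment v (b ! k \<noteq> 0) (k \<in> A) (k \<in> D) * cov1 (b ! k) (a ! k)"
        using level_pairs_moments(3)[OF v b(2)[OF k] a(2)[OF k]] by (simp add: case_prod_unfold mult.commute)
      also have "\<dots> = cross_moment v (a ! k \<noteq> 0) (k \<in> A) (k \<in> D) * cov1 (a ! k) (b ! k)"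
        by (auto simp: cov1_def)
      finally show "(\<Sum>y\<in>?W k. lev v (snd y) (a ! k) * lev v (fst y) (b ! k)) =
          cross_moment v (k \<in> supp a) (k \<in> A) (k \<in> D) * cov1 (a ! k) (b ! k)" using s[OF k] by simp
    qed
    have "(\<Sum>w\<in>prodlists K ?W. phi_diff v K (map fst w, map snd w) a * phi_diff v K (map fst w, map snd w) b) =
        (\<Sum>w\<in>prodlists K ?W. phi v K (map fst w) a * phi v K (map fst w) b) -
        (\<Sum>w\<in>prodlists K ?W. phi v K (map fst w) a * phi v K (map snd w) b) -
        (\<Sum>w\<in>prodlists K ?W. phi v K (map snd w) a * phi v K (map fst w) b) +
        (\<Sum>w\<in>prodlists K ?W. phi v K (map snd w) a * phi v K (map snd w) b)"
      by (simp add: phi_diff_def algebra_simps sum.distrib sum_subtractf)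
    then show ?thesis unfolding fact same cross1 cross2 by (simp add: algebra_simps)
  qed
  then show ?thesis
    unfolding sum_design_region_d mass_def sum_distrib_right by (simp add: case_prod_unfold)
qed

section \<open>Orthogonality of different supports and symmetry in the attributes\<close>

lemma supp_neqE:
  assumes "length a = K" "length b = K" "supp a \<noteq> supp b"
  obtains k where "k < K" "(a ! k = 0) \<noteq> (b ! k = 0)"
proof -
  have "\<exists>k<K. (a ! k = 0) \<noteq> (b ! k = 0)"
  proof (rule ccontr)
    assume "\<not> (\<exists>k<K. (a ! k = 0) \<noteq> (b ! k = 0))"
    then have "supp a = supp b" using assms(1,2) unfolding supp_def by (intro Collect_cong) auto
    then show False using assms(3) by simp
  qed
  then show ?thesis using that by blast
qed

lemma cov_eq_0:
  assumes "length a = K" "length b = K" "supp a \<noteq> supp b"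
  shows "cov K a b = 0"
proof -
  obtain k where "k < K" "(a ! k = 0) \<noteq> (b ! k = 0)"
    using supp_neqE[OF assms] .
  then show ?thesis unfolding cov_def by (intro prod_zero) (auto simp: cov1_def intro!: bexI[of _ k])
qed

lemma prec_eq_0:
  assumes "length a = K" "length b = K" "supp a \<noteq> supp b"
  shows "prec v K a b = 0"
proof -
  obtain k where "k < K" "(a ! k = 0) \<noteq> (b ! k = 0)"
    using supp_neqE[OF assms] .
  then show ?thesis unfolding prec_def by (intro prod_zero) (auto simp: prec1_def intro!: bexI[of _ k])
qed

text \<open>Bijections from \<open>T\<close> to \<open>T'\<close> and between their complements in
  \<open>U\<close> exist by cardinality and glue to one permutation.\<close>

lemma exists_permutes_image_eq:
  assumes "finite U" "T \<subseteq> U" "T' \<subseteq> U" "card T = card T'"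
  shows "\<exists>\<pi>. \<pi> permutes U \<and> \<pi> ` T = T'"
proof -
  have fin: "finite T" "finite T'" using assms finite_subset by auto
  obtain f where f: "bij_betw f T T'"
    using finite_same_card_bij[OF fin assms(4)] by blast
  have "card (U - T) = card (U - T')" using assms fin by (simp add: card_Diff_subset)
  then obtain g where g: "bij_betw g (U - T) (U - T')"
    using finite_same_card_bij[of "U - T" "U - T'"] assms(1) by auto
  define \<pi> where "\<pi> k = (if k \<in> T then f k else if k \<in> U then g k else k)" for k
  have "bij_betw \<pi> T T'" using f by (rule bij_betw_cong[THEN iffD1, rotated]) (simp add: \<pi>_def)
  moreover have "bij_betw \<pi> (U - T) (U - T')"
    using g by (rule bij_betw_cong[THEN iffD1, rotated]) (simp add: \<pi>_def)
  ultimately have "bij_betw \<pi> (T \<union> (U - T)) (T' \<union> (U - T'))" by (rule bij_betw_combine) auto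
  then have "bij_betw \<pi> U U" using assms(2,3) by (simp add: Un_absorb1)
  then have "\<pi> permutes U" by (rule bij_imp_permutes) (use assms(2) in \<open>auto simp: \<pi>_def\<close>)
  moreover have "\<pi> ` T = T'" using \<open>bij_betw \<pi> T T'\<close> by (rule bij_betw_imp_surj_on)
  ultimately show ?thesis by blast
qed

text \<open>A permutation of the attributes carrying \<open>T\<close> to \<open>T'\<close> also
  permutes \<open>depth_sets\<close>, and each product depends only on memberships. Hence all
  triples share one constant, which is never computed from this formula.\<close>

lemma mass_eq:
  assumes "T \<subseteq> {..<K}" "T' \<subseteq> {..<K}" "card T = card T'"
  shows "mass v K S d T = mass v K S d T'"
proof -
  obtain \<pi> where \<pi>: "\<pi> permutes {..<K}" "\<pi> ` T = T'"
    using exists_permutes_image_eq[of "{..<K}" T T'] assms by auto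
  have mem: "\<pi> k \<in> \<pi> ` B \<longleftrightarrow> k \<in> B" for k B
    using permutes_inj[OF \<pi>(1)] by (rule inj_image_mem_iff)
  have reindex: "(\<Prod>k<K. h (k \<in> T) (k \<in> A) (k \<in> D)) = (\<Prod>k<K. h (k \<in> T') (k \<in> \<pi> ` A) (k \<in> \<pi> ` D))"
    for h :: "bool \<Rightarrow> bool \<Rightarrow> bool \<Rightarrow> real" and A D
    using prod.reindex_bij_betw[OF permutes_imp_bij[OF \<pi>(1)], of "\<lambda>k. h (k \<in> T') (k \<in> \<pi> ` A) (k \<in> \<pi> ` D)"]
    by (simp add: mem \<pi>(2)[symmetric])
  have image: "(\<rho> ` A, \<rho> ` D) \<in> depth_sets K S d" if "\<rho> permutes {..<K}" "(A, D) \<in> depth_sets K S d" for \<rho> A D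
  proof -
    have "\<rho> ` A \<subseteq> {..<K}" using that permutes_image[OF that(1)] by (auto simp: depth_sets_def)
    moreover have "card (\<rho> ` B) = card B" for B
      by (rule card_image) (rule inj_on_subset[OF permutes_inj[OF that(1)] subset_UNIV])
    ultimately show ?thesis using that(2) by (auto simp: depth_sets_def)
  qed
  show ?thesis unfolding mass_def
  proof (rule sum.reindex_bij_witness[of _ "\<lambda>(A, D). (inv_into UNIV \<pi> ` A, inv_into UNIV \<pi> ` D)" "\<lambda>(A, D). (\<pi> ` A, \<pi> ` D)"], goal_cases)
    case (1 y)
    then show ?case by (cases y) (simp add: image_comp permutes_inv_o[OF \<pi>(1)])
  next
    case (2 y)
    then show ?case using image[OF \<pi>(1)] by (cases y) simp
  next
    case (3 y)
    then show ?case by (cases y) (simp add: image_comp permutes_inv_o[OF \<pi>(1)])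
  next
    case (4 y)
    then show ?case using image[OF permutes_inv[OF \<pi>(1)]] by (cases y) simp
  next
    case (5 y)
    then show ?case by (cases y) (simp add: reindex[symmetric])
  qed
qed

section \<open>The quadratic form of the inverse\<close>

lemma effectsD:
  assumes "a \<in> effects v K n"
  shows "length a = K" "\<And>k. k < K \<Longrightarrow> a ! k < v" "card (supp a) = n" "supp a \<subseteq> {..<K}"
  using assms by (auto simp: effects_def supp_def)

lemma sum_effects_same_supp:
  assumes v: "0 < v" and a: "a \<in> effects v K n"
    and h: "\<And>b. b \<in> effects v K n \<Longrightarrow> supp b \<noteq> supp a \<Longrightarrow> h b = 0"
  shows "(\<Sum>b\<in>effects v K n. h b) = (\<Sum>b\<in>effects_on v K (supp a). h b)"
proof -
  have "effects_on v K (supp a) = {b \<in> effects v K n. supp b = supp a}"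
    using effects_with_supp[OF v, of "supp a" K n] effectsD[OF a] by simp
  then show ?thesis using h by (intro sum.mono_neutral_right) auto
qed

lemma sum_cov1_prec1:
  assumes "1 \<le> r" "r < v" "s < v"
  shows "(\<Sum>y=1..<v. cov1 r y * prec1 v y s) = (if r = s then 1 else 0)"
proof (cases "s = 0")
  case True
  then show ?thesis using assms by (auto simp: prec1_def intro!: sum.neutral)
next
  case False
  \<comment> \<open>For nonzero indices \<open>cov1 r y\<close> is 1 plus the indicator of
    \<open>y = r\<close>, as in \<open>I + J\<close>; the two parts of the product are summed
    separately.\<close>
  have "(\<Sum>y=1..<v. cov1 r y * prec1 v y s) =
      (\<Sum>y=1..<v. (if y = r then (if r = s then 1 else 0) - 1 / real v else 0) + ((if y = s then 1 else 0) - 1 / real v))"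
    using assms False by (intro sum.cong) (auto simp: cov1_def prec1_def)
  also have "\<dots> = (if r = s then 1 else 0) - 1 / real v + (1 - (real v - 1) / real v)"
    using assms False by (simp add: sum.distrib sum_subtractf of_nat_diff)
  also have "\<dots> = (if r = s then 1 else 0)" using assms by (simp add: field_simps)
  finally show ?thesis .
qed

text \<open>Both kernels vanish between different supports, so only indices with the support of
  \<open>a\<close> survive. On that product set the inversion takes place attribute by
  attribute.\<close>

lemma cov_mult_prec:
  assumes v: "0 < v" and a: "a \<in> effects v K n" and c: "c \<in> effects v K n"
  shows "(\<Sum>b\<in>effects v K n. cov K a b * prec v K b c) = (if a = c then 1 else 0)"
proof -
  let ?W = "\<lambda>k. if k \<in> supp a then {1..<v} else {0}"
  note aD = effectsD[OF a] and cD = effectsD[OF c]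
  have "(\<Sum>b\<in>effects v K n. cov K a b * prec v K b c) = (\<Sum>b\<in>effects_on v K (supp a). cov K a b * prec v K b c)"
    using aD by (intro sum_effects_same_supp[OF v a]) (metis cov_eq_0 effectsD(1) mult_zero_left)
  also have "\<dots> = (\<Sum>b\<in>prodlists K ?W. \<Prod>k<K. cov1 (a ! k) (b ! k) * prec1 v (b ! k) (c ! k))"
    by (simp add: effects_on_def cov_def prec_def prod.distrib)
  also have "\<dots> = (\<Prod>k<K. \<Sum>y\<in>?W k. cov1 (a ! k) y * prec1 v y (c ! k))"
    by (rule sum_prod_prodlists[where u = "\<lambda>k y. cov1 (a ! k) y * prec1 v y (c ! k)"])
  also have "\<dots> = (\<Prod>k<K. if a ! k = c ! k then 1 else 0)"
  proof (rule prod.cong[OF refl])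
    fix k assume "k \<in> {..<K}"
    then have k: "k < K" by simp
    show "(\<Sum>y\<in>?W k. cov1 (a ! k) y * prec1 v y (c ! k)) = (if a ! k = c ! k then 1 else 0)"
    proof (cases "k \<in> supp a")
      case True
      then have "1 \<le> a ! k" by (simp add: supp_def)
      then show ?thesis using True sum_cov1_prec1[of "a ! k" v "c ! k"] aD(2)[OF k] cD(2)[OF k] by simp
    next
      case False
      then have "a ! k = 0" using k aD(1) by (simp add: supp_def)
      then show ?thesis using False by (simp add: cov1_def prec1_def)
    qed
  qed
  also have "\<dots> = (if a = c then 1 else 0)"
  proof (cases "a = c")
    case False
    then obtain k where "k < K" "a ! k \<noteq> c ! k" using aD(1) cD(1) by (metis nth_equalityI)
    then show ?thesis using False by (auto intro!: prod_zero)
  qed simp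
  finally show ?thesis .
qed

section \<open>The quadratic form as a sum over triples of attributes\<close>

text \<open>The inner product of \<open>f1\<close> at \<open>p\<close> and at \<open>q\<close> with
  respect to \<open>I - J / v\<close>. For shown levels it is the centring matrix of order
  \<open>v\<close>, symmetric in all levels although \<open>f1\<close> singles out level
  \<open>v\<close>.\<close>

definition kappa :: "nat \<Rightarrow> nat \<Rightarrow> nat \<Rightarrow> real" where
  "kappa v p q = (if p = 0 \<or> q = 0 then 0 else (if p = q then 1 else 0) - 1 / real v)"

text \<open>The component index \<open>r\<close> doubles as the level at which \<open>f1\<close> is
  the \<open>r\<close>-th unit vector, which is why \<open>kappa\<close> may take it as a
  level.\<close>

lemma sum_prec1_lev:
  assumes "1 \<le> r" "r < v" "q \<le> v"
  shows "(\<Sum>s=1..<v. prec1 v r s * lev v q s) = kappa v r q"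
proof -
  consider "q = 0" | "1 \<le> q" "q < v" | "q = v" using assms by linarith
  then show ?thesis
  proof cases
    case 1
    then show ?thesis using assms by (auto simp: lev_def kappa_def intro!: sum.neutral)
  next
    case 2
    have "(\<Sum>s=1..<v. prec1 v r s * lev v q s) = (\<Sum>s=1..<v. if s = q then kappa v r q else 0)"
      using assms 2 by (intro sum.cong) (auto simp: lev_def kappa_def prec1_def)
    then show ?thesis using 2 by simp
  next
    case 3
    have "(\<Sum>s=1..<v. prec1 v r s * lev v q s) = (\<Sum>s=1..<v. 1 / real v - (if s = r then 1 else 0))"
      using assms 3 by (intro sum.cong) (auto simp: lev_def prec1_def)
    also have "\<dots> = (real v - 1) / real v - 1" using assms by (simp add: sum_subtractf of_nat_diff)
    also have "\<dots> = kappa v r q" using assms 3 by (simp add: kappa_def field_simps)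
    finally show ?thesis .
  qed
qed

text \<open>For \<open>p = v\<close> all coefficients are -1, and the result is again
  \<open>kappa\<close> because \<open>kappa\<close> sums to zero over the levels.\<close>

lemma sum_lev_kappa:
  assumes "2 \<le> v" "p \<le> v" "q \<le> v"
  shows "(\<Sum>r=1..<v. lev v p r * kappa v r q) = kappa v p q"
proof -
  consider "p = 0" | "1 \<le> p" "p < v" | "p = v" using assms by linarith
  then show ?thesis
  proof cases
    case 1
    then show ?thesis using assms by (auto simp: lev_def kappa_def intro!: sum.neutral)
  next
    case 2
    have "(\<Sum>r=1..<v. lev v p r * kappa v r q) = (\<Sum>r=1..<v. if r = p then kappa v p q else 0)"
      using assms 2 by (intro sum.cong) (auto simp: lev_def)
    then show ?thesis using 2 by simp
  next
    case 3
    show ?thesis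
    proof (cases "q = 0")
      case False
      have "(\<Sum>r=1..<v. lev v p r * kappa v r q) = (\<Sum>r=1..<v. 1 / real v - (if r = q then 1 else 0))"
        using assms 3 False by (intro sum.cong) (auto simp: lev_def kappa_def)
      also have "\<dots> = (real v - 1) / real v - (if q < v then 1 else 0)"
        using assms False by (simp add: sum_subtractf of_nat_diff)
      also have "\<dots> = kappa v p q" using assms 3 False by (auto simp: kappa_def field_simps)
      finally show ?thesis .
    qed (simp add: kappa_def)
  qed
qed

lemma prec_bilinear:
  assumes v: "2 \<le> v" and i: "\<And>k. k < K \<Longrightarrow> i ! k \<le> v" and j: "\<And>k. k < K \<Longrightarrow> j ! k \<le> v"
  shows "(\<Sum>a\<in>effects v K n. \<Sum>b\<in>effects v K n. phi v K i a * prec v K a b * phi v K j b) =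
    (\<Sum>T | T \<subseteq> {..<K} \<and> card T = n. \<Prod>k\<in>T. kappa v (i ! k) (j ! k))"
proof -
  have v0: "0 < v" using v by simp
  let ?W = "\<lambda>T k. if k \<in> T then {1..<v} else {0 :: nat}"
  \<comment> \<open>An attribute outside the support must contribute 1, whereas \<open>kappa\<close>
    is 0 at index 0; hence the case distinction.\<close>
  have inner: "(\<Sum>b\<in>effects v K n. phi v K i a * prec v K a b * phi v K j b) =
      (\<Prod>k<K. lev v (i ! k) (a ! k) * (if a ! k = 0 then 1 else kappa v (a ! k) (j ! k)))"
    if a: "a \<in> effects v K n" for a
  proof -
    note aD = effectsD[OF a]
    have "(\<Sum>b\<in>effects v K n. prec v K a b * phi v K j b) =
        (\<Sum>b\<in>effects_on v K (supp a). prec v K a b * phi v K j b)"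
      using aD by (intro sum_effects_same_supp[OF v0 a]) (metis prec_eq_0 effectsD(1) mult_zero_left)
    also have "\<dots> = (\<Sum>b\<in>prodlists K (?W (supp a)). \<Prod>k<K. prec1 v (a ! k) (b ! k) * lev v (j ! k) (b ! k))"
      by (simp add: effects_on_def prec_def phi_def prod.distrib)
    also have "\<dots> = (\<Prod>k<K. \<Sum>y\<in>?W (supp a) k. prec1 v (a ! k) y * lev v (j ! k) y)"
      by (rule sum_prod_prodlists[where u = "\<lambda>k y. prec1 v (a ! k) y * lev v (j ! k) y"])
    also have "\<dots> = (\<Prod>k<K. if a ! k = 0 then 1 else kappa v (a ! k) (j ! k))"
    proof (rule prod.cong[OF refl])
      fix k assume "k \<in> {..<K}"
      then have k: "k < K" by simp
      then have "k \<in> supp a \<longleftrightarrow> a ! k \<noteq> 0" using aD(1) by (simp add: supp_def)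
      then show "(\<Sum>y\<in>?W (supp a) k. prec1 v (a ! k) y * lev v (j ! k) y) =
          (if a ! k = 0 then 1 else kappa v (a ! k) (j ! k))"
        using sum_prec1_lev[of "a ! k" v "j ! k"] aD(2)[OF k] j[OF k] by (auto simp: prec1_def)
    qed
    finally show ?thesis by (simp add: phi_def prod.distrib mult.assoc sum_distrib_left[symmetric])
  qed
  have "(\<Sum>a\<in>effects v K n. \<Sum>b\<in>effects v K n. phi v K i a * prec v K a b * phi v K j b) =
      (\<Sum>T | T \<subseteq> {..<K} \<and> card T = n. \<Sum>a\<in>effects_on v K T.
        \<Prod>k<K. lev v (i ! k) (a ! k) * (if a ! k = 0 then 1 else kappa v (a ! k) (j ! k)))"
    using inner by (simp add: sum_effects[OF v0, symmetric])
  also have "\<dots> = (\<Sum>T | T \<subseteq> {..<K} \<and> card T = n. \<Prod>k\<in>T. kappa v (i ! k) (j ! k))"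
  proof (rule sum.cong[OF refl])
    fix T assume "T \<in> {T. T \<subseteq> {..<K} \<and> card T = n}"
    then have T: "T \<subseteq> {..<K}" by simp
    have "(\<Sum>a\<in>effects_on v K T. \<Prod>k<K. lev v (i ! k) (a ! k) * (if a ! k = 0 then 1 else kappa v (a ! k) (j ! k))) =
        (\<Prod>k<K. \<Sum>y\<in>?W T k. lev v (i ! k) y * (if y = 0 then 1 else kappa v y (j ! k)))"
      unfolding effects_on_def
      by (rule sum_prod_prodlists[where u = "\<lambda>k y. lev v (i ! k) y * (if y = 0 then 1 else kappa v y (j ! k))"])
    also have "\<dots> = (\<Prod>k<K. if k \<in> T then kappa v (i ! k) (j ! k) else 1)"
    proof (rule prod.cong[OF refl])
      fix k assume "k \<in> {..<K}"
      then have k: "k < K" by simp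
      have "(\<Sum>y=1..<v. lev v (i ! k) y * (if y = 0 then 1 else kappa v y (j ! k))) =
          (\<Sum>y=1..<v. lev v (i ! k) y * kappa v y (j ! k))"
        by (rule sum.cong) auto
      then show "(\<Sum>y\<in>?W T k. lev v (i ! k) y * (if y = 0 then 1 else kappa v y (j ! k))) =
          (if k \<in> T then kappa v (i ! k) (j ! k) else 1)"
        using sum_lev_kappa[OF v i[OF k] j[OF k]] by simp
    qed
    also have "\<dots> = (\<Prod>k\<in>T. kappa v (i ! k) (j ! k))"
      using T by (intro prod.mono_neutral_cong_right) auto
    finally show "(\<Sum>a\<in>effects_on v K T. \<Prod>k<K. lev v (i ! k) (a ! k) * (if a ! k = 0 then 1 else kappa v (a ! k) (j ! k))) =
        (\<Prod>k\<in>T. kappa v (i ! k) (j ! k))" .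
  qed
  finally show ?thesis .
qed

section \<open>Elementary symmetric polynomials through power sums\<close>

definition esym :: "nat \<Rightarrow> 'a set \<Rightarrow> ('a \<Rightarrow> real) \<Rightarrow> real" where
  "esym n A y = (\<Sum>T | T \<subseteq> A \<and> card T = n. \<Prod>k\<in>T. y k)"

lemma esym_0: "finite A \<Longrightarrow> esym 0 A y = 1"
proof -
  assume "finite A"
  then have "{T. T \<subseteq> A \<and> card T = 0} = {{}}" by (auto dest: finite_subset)
  then show ?thesis by (simp add: esym_def)
qed

text \<open>Split the subsets of \<open>insert x A\<close> according to whether they contain
  \<open>x\<close>.\<close>

lemma esym_Suc_insert:
  assumes A: "finite A" "x \<notin> A"
  shows "esym (Suc n) (insert x A) y = esym (Suc n) A y + y x * esym n A y"
proof -
  let ?P = "{T. T \<subseteq> A \<and> card T = Suc n}" and ?Q = "{T. T \<subseteq> A \<and> card T = n}"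
  have fin: "finite T" if "T \<subseteq> A" for T using that A(1) by (rule finite_subset)
  have "{T. T \<subseteq> insert x A \<and> card T = Suc n} = ?P \<union> insert x ` ?Q"
  proof (intro equalityI subsetI)
    fix T assume T: "T \<in> {T. T \<subseteq> insert x A \<and> card T = Suc n}"
    show "T \<in> ?P \<union> insert x ` ?Q"
    proof (cases "x \<in> T")
      case True
      then have "T = insert x (T - {x})" "T - {x} \<subseteq> A" "card (T - {x}) = n" using T by auto
      then show ?thesis by blast
    qed (use T in auto)
  next
    fix T assume "T \<in> ?P \<union> insert x ` ?Q"
    then show "T \<in> {T. T \<subseteq> insert x A \<and> card T = Suc n}"
    proof
      assume "T \<in> insert x ` ?Q"
      then obtain U where U: "T = insert x U" "U \<subseteq> A" "card U = n" by auto
      then have "card T = Suc n" using A fin[OF U(2)] by (subst U(1), subst card_insert_disjoint) auto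
      then show ?thesis using U by auto
    qed auto
  qed
  then have "esym (Suc n) (insert x A) y = (\<Sum>T\<in>?P. \<Prod>k\<in>T. y k) + (\<Sum>T\<in>insert x ` ?Q. \<Prod>k\<in>T. y k)"
    unfolding esym_def using A by (simp only:) (intro sum.union_disjoint, auto)
  also have "(\<Sum>T\<in>insert x ` ?Q. \<Prod>k\<in>T. y k) = (\<Sum>T\<in>?Q. \<Prod>k\<in>insert x T. y k)"
  proof -
    have "inj_on (insert x) ?Q" using A(2) by (intro inj_onI) (auto dest!: insert_ident[THEN iffD1, rotated 2])
    then show ?thesis by (simp add: sum.reindex)
  qed
  also have "\<dots> = (\<Sum>T\<in>?Q. y x * (\<Prod>k\<in>T. y k))"
    using A(2) fin by (intro sum.cong[OF refl] prod.insert) auto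
  finally show ?thesis by (simp add: esym_def sum_distrib_left)
qed

lemma esym_Suc_empty: "esym (Suc n) {} y = 0"
  unfolding esym_def by (rule sum.neutral) auto

lemma esym_1: "finite A \<Longrightarrow> esym 1 A y = sum y A"
  by (induction A rule: finite_induct) (simp_all add: esym_Suc_empty esym_Suc_insert esym_0)

lemma esym_2: "finite A \<Longrightarrow> 2 * esym 2 A y = (sum y A)\<^sup>2 - (\<Sum>k\<in>A. y k ^ 2)"
proof (induction A rule: finite_induct)
  case empty
  then show ?case by (simp add: esym_Suc_empty numeral_2_eq_2)
next
  case (insert x A)
  have "esym 2 (insert x A) y = esym 2 A y + y x * sum y A"
    using esym_Suc_insert[OF insert(1,2), of 1 y] esym_1[OF insert(1), of y] by (simp add: numeral_2_eq_2)
  then show ?case using insert by (simp add: algebra_simps power2_eq_square)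
qed

text \<open>Newton's identity in degree three. Power sums are preferred because they can be
  evaluated by counting attributes.\<close>

lemma esym_3:
  "finite A \<Longrightarrow> 6 * esym 3 A y = (sum y A) ^ 3 - 3 * sum y A * (\<Sum>k\<in>A. y k ^ 2) + 2 * (\<Sum>k\<in>A. y k ^ 3)"
proof (induction A rule: finite_induct)
  case empty
  then show ?case by (simp add: esym_Suc_empty numeral_3_eq_3)
next
  case (insert x A)
  have "esym 3 (insert x A) y = esym 3 A y + y x * esym 2 A y"
    using esym_Suc_insert[OF insert(1,2), of 2 y] by (simp add: numeral_3_eq_3 numeral_2_eq_2)
  then have "6 * esym 3 (insert x A) y = 6 * esym 3 A y + 3 * y x * (2 * esym 2 A y)" by simp
  also have "\<dots> = (sum y (insert x A)) ^ 3 - 3 * sum y (insert x A) * (\<Sum>k\<in>insert x A. y k ^ 2) +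
      2 * (\<Sum>k\<in>insert x A. y k ^ 3)"
    unfolding insert.IH esym_2[OF insert(1)] using insert(1,2)
    by (simp add: algebra_simps power2_eq_square power3_eq_cube)
  finally show ?case .
qed

section \<open>Optimality\<close>

lemma design_region_levels:
  assumes "x \<in> design_region v K S" "k < K"
  shows "fst x ! k \<le> v" "snd x ! k \<le> v"
proof -
  have "(fst x ! k, snd x ! k) \<in> {0..v} \<times> {0..v}"
    using assms by (intro subsetD[OF level_pairs_subset[of v "k \<in> supp (fst x)" "k \<in> diff_set x"]])
      (simp add: design_region_iff)
  then show "fst x ! k \<le> v" "snd x ! k \<le> v" by auto
qed

lemma sum_nested_cases:
  fixes \<alpha> \<beta> :: real and K :: nat
  assumes "A \<subseteq> {..<K}" "D \<subseteq> A"
  shows "(\<Sum>k<K. if k \<in> D then \<alpha> else if k \<in> A then \<beta> else 0) =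
    real (card D) * \<alpha> + (real (card A) - real (card D)) * \<beta>"
proof -
  have fin: "finite A" "finite D"
    using assms finite_subset[of A "{..<K}"] finite_subset[of D "{..<K}"] by auto
  have "(\<Sum>k<K. if k \<in> D then \<alpha> else if k \<in> A then \<beta> else 0) = (\<Sum>k\<in>A. if k \<in> D then \<alpha> else \<beta>)"
    using assms by (intro sum.mono_neutral_cong_right) auto
  also have "\<dots> = (\<Sum>k\<in>D. \<alpha>) + (\<Sum>k\<in>A - D. \<beta>)"
    using assms fin by (subst sum.subset_diff[OF assms(2) fin(1)]) (simp add: add.commute)
  finally show ?thesis using assms fin by (simp add: card_Diff_subset card_mono of_nat_diff)
qed

text \<open>The arguments take one value on \<open>D\<close>, one on \<open>A - D\<close> and 0
  elsewhere, so the power sums depend only on the two cardinalities. This is why the quadratic form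
  depends on a pair only through its depth.\<close>

lemma esym_3_nested_cases:
  fixes K :: nat
  assumes AD: "A \<subseteq> {..<K}" "D \<subseteq> A"
    and kappa: "\<And>k. k < K \<Longrightarrow> y k = (if k \<in> D then - 1 / real v else if k \<in> A then 1 - 1 / real v else 0)"
  shows "6 * esym 3 {..<K} y =
    (real (card D) * (- 1 / real v) + (real (card A) - real (card D)) * (1 - 1 / real v)) ^ 3
    - 3 * (real (card D) * (- 1 / real v) + (real (card A) - real (card D)) * (1 - 1 / real v))
        * (real (card D) * (- 1 / real v) ^ 2 + (real (card A) - real (card D)) * (1 - 1 / real v) ^ 2)
    + 2 * (real (card D) * (- 1 / real v) ^ 3 + (real (card A) - real (card D)) * (1 - 1 / real v) ^ 3)"
proof -
  have "(\<Sum>k<K. y k ^ n) = real (card D) * (- 1 / real v) ^ n + (real (card A) - real (card D)) * (1 - 1 / real v) ^ n"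
    if "0 < n" for n
  proof -
    have "(\<Sum>k<K. y k ^ n) =
        (\<Sum>k<K. if k \<in> D then (- 1 / real v) ^ n else if k \<in> A then (1 - 1 / real v) ^ n else 0)"
      using that kappa by (intro sum.cong) auto
    then show ?thesis using sum_nested_cases[OF AD] by simp
  qed
  from this[of 1] this[of 2] this[of 3] show ?thesis
    unfolding esym_3[OF finite_lessThan] by simp
qed

text \<open>Expanding the differences gives four bilinear forms, each an elementary symmetric
  polynomial of degree three in values of \<open>kappa\<close>. The constant in front of
  \<open>h3\<close> cancels its denominator up to \<open>v\<close> squared and leaves one third of
  its numerator.\<close>

lemma prec_quadratic_form:
  assumes v: "2 \<le> v" and K: "3 \<le> K" and x: "x \<in> design_region v K S"
  shows "(\<Sum>a\<in>effects v K 3. \<Sum>b\<in>effects v K 3. phi_diff v K x a * prec v K a b * phi_diff v K x b) =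
    4 * real K * (real K - 1) * (real K - 2) / 3 * h3 v K S (card (diff_set x))"
proof -
  define i j where "i = fst x" and "j = snd x"
  define A D where "A = supp i" and "D = diff_set x"
  have len: "length i = K" "length j = K" using x by (auto simp: design_region_iff i_def j_def)
  have cA: "card A = S" using x by (simp add: design_region_iff i_def A_def)
  have AK: "A \<subseteq> {..<K}" using supp_subset[OF len(1)] by (simp add: A_def)
  have DA: "D \<subseteq> A" using diff_set_subset_supp[OF x] by (simp add: A_def D_def i_def)
  have lv: "(i ! k, j ! k) \<in> level_pairs v (k \<in> A) (k \<in> D)" if "k < K" for k
    using x that by (simp add: design_region_iff i_def j_def A_def D_def)
  \<comment> \<open>The test \<open>k \<in> {}\<close> gives the values at equal profiles the shape
    of \<open>esym_3_nested_cases\<close> with empty \<open>D\<close>.\<close>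
  have ii: "kappa v (i ! k) (i ! k) = (if k \<in> {} then - 1 / real v else if k \<in> A then 1 - 1 / real v else 0)"
    and jj: "kappa v (j ! k) (j ! k) = (if k \<in> {} then - 1 / real v else if k \<in> A then 1 - 1 / real v else 0)"
    and ij: "kappa v (i ! k) (j ! k) = (if k \<in> D then - 1 / real v else if k \<in> A then 1 - 1 / real v else 0)"
    and ji: "kappa v (j ! k) (i ! k) = (if k \<in> D then - 1 / real v else if k \<in> A then 1 - 1 / real v else 0)"
    if kK: "k < K" for k
  proof -
    consider "k \<in> D" "i ! k \<noteq> 0" "j ! k \<noteq> 0" "i ! k \<noteq> j ! k" | "k \<notin> D" "k \<in> A" "i ! k \<noteq> 0" "j ! k = i ! k"
      | "k \<notin> D" "k \<notin> A" "i ! k = 0" "j ! k = 0"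
      using lv[OF kK] DA by (cases "k \<in> D"; cases "k \<in> A") (auto simp: level_pairs_def)
    note cs = this
    show "kappa v (i ! k) (i ! k) = (if k \<in> {} then - 1 / real v else if k \<in> A then 1 - 1 / real v else 0)"
      using cs DA by cases (auto simp: kappa_def)
    show "kappa v (j ! k) (j ! k) = (if k \<in> {} then - 1 / real v else if k \<in> A then 1 - 1 / real v else 0)"
      using cs DA by cases (auto simp: kappa_def)
    show "kappa v (i ! k) (j ! k) = (if k \<in> D then - 1 / real v else if k \<in> A then 1 - 1 / real v else 0)"
      using cs by cases (auto simp: kappa_def)
    show "kappa v (j ! k) (i ! k) = (if k \<in> D then - 1 / real v else if k \<in> A then 1 - 1 / real v else 0)"
      using cs by cases (auto simp: kappa_def)
  qed
  have bil: "(\<Sum>a\<in>effects v K 3. \<Sum>b\<in>effects v K 3. phi v K i' a * prec v K a b * phi v K j' b) =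
      esym 3 {..<K} (\<lambda>k. kappa v (i' ! k) (j' ! k))" if "i' \<in> {i, j}" "j' \<in> {i, j}" for i' j'
    unfolding esym_def using that design_region_levels[OF x]
    by (intro prec_bilinear[OF v]) (auto simp: i_def j_def)
  have "(\<Sum>a\<in>effects v K 3. \<Sum>b\<in>effects v K 3. phi_diff v K x a * prec v K a b * phi_diff v K x b) =
      (\<Sum>a\<in>effects v K 3. \<Sum>b\<in>effects v K 3. phi v K i a * prec v K a b * phi v K i b)
    - (\<Sum>a\<in>effects v K 3. \<Sum>b\<in>effects v K 3. phi v K i a * prec v K a b * phi v K j b)
    - (\<Sum>a\<in>effects v K 3. \<Sum>b\<in>effects v K 3. phi v K j a * prec v K a b * phi v K i b)
    + (\<Sum>a\<in>effects v K 3. \<Sum>b\<in>effects v K 3. phi v K j a * prec v K a b * phi v K j b)"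
    by (simp add: phi_diff_def i_def j_def left_diff_distrib right_diff_distrib sum.distrib sum_subtractf)
  also have "\<dots> = esym 3 {..<K} (\<lambda>k. kappa v (i ! k) (i ! k)) - esym 3 {..<K} (\<lambda>k. kappa v (i ! k) (j ! k))
    - esym 3 {..<K} (\<lambda>k. kappa v (j ! k) (i ! k)) + esym 3 {..<K} (\<lambda>k. kappa v (j ! k) (j ! k))"
    by (simp add: bil)
  finally have eq: "6 * (\<Sum>a\<in>effects v K 3. \<Sum>b\<in>effects v K 3. phi_diff v K x a * prec v K a b * phi_diff v K x b) =
    6 * esym 3 {..<K} (\<lambda>k. kappa v (i ! k) (i ! k)) - 6 * esym 3 {..<K} (\<lambda>k. kappa v (i ! k) (j ! k))
    - 6 * esym 3 {..<K} (\<lambda>k. kappa v (j ! k) (i ! k)) + 6 * esym 3 {..<K} (\<lambda>k. kappa v (j ! k) (j ! k))"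
    by simp
  note e = esym_3_nested_cases[OF AK]
  have nz: "real v \<noteq> 0" "real K \<noteq> 0" "real K - 1 \<noteq> 0" "real K - 2 \<noteq> 0" using v K by auto
  define u s d where "u = real v" and "s = real S" and "d = real (card D)"
  \<comment> \<open>\<open>Z\<close> is \<open>d\<close> times the polynomial \<open>lam\<close> of
    \<open>h3\<close>, over \<open>u\<close> squared. \<open>Y\<close> and \<open>Y0\<close> are six
    times the forms for opposite profiles and for a profile with itself; what remains is the
    polynomial identity \<open>Y0 - Y = Z\<close>.\<close>
  define Z where "Z = d * (3*s^2 + 3*s^2*u^2 - 6*s^2*u - 3*s*d*u^2 + 3*s*d*u - 6*s*u^2 + 15*s*u - 9*s
           + d^2*u^2 + 3*d*u^2 - 6*d*u + 2*u^2 - 6*u + 6) / u\<^sup>2"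
  define Y where "Y = (d * (- 1/u) + (s - d) * (1 - 1/u)) ^ 3
      - 3 * (d * (- 1/u) + (s - d) * (1 - 1/u)) * (d * (- 1/u)\<^sup>2 + (s - d) * (1 - 1/u)\<^sup>2)
      + 2 * (d * (- 1/u) ^ 3 + (s - d) * (1 - 1/u) ^ 3)"
  define Y0 where "Y0 = (s * (1 - 1/u)) ^ 3 - 3 * (s * (1 - 1/u)) * (s * (1 - 1/u)\<^sup>2) + 2 * (s * (1 - 1/u) ^ 3)"
  have "Y0 - Y = Z"
    using nz(1) unfolding u_def[symmetric] Y_def Y0_def Z_def
    by (simp add: field_simps power2_eq_square power3_eq_cube)
  moreover have "4 * (real K * (real K - 1) * (real K - 2) * h3 v K S (card D)) = Z"
    using nz by (simp add: h3_def Let_def u_def s_def d_def Z_def)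
  moreover have "6 * esym 3 {..<K} (\<lambda>k. kappa v (i ! k) (i ! k)) = Y0"
    "6 * esym 3 {..<K} (\<lambda>k. kappa v (j ! k) (j ! k)) = Y0"
    using e[of "{}", OF _ ii] e[of "{}", OF _ jj] by (simp_all add: Y0_def u_def s_def cA)
  moreover have "6 * esym 3 {..<K} (\<lambda>k. kappa v (i ! k) (j ! k)) = Y"
    "6 * esym 3 {..<K} (\<lambda>k. kappa v (j ! k) (i ! k)) = Y"
    using e[OF DA ij] e[OF DA ji] by (simp_all only: Y_def u_def s_def d_def cA)
  ultimately show ?thesis using eq by (simp add: D_def)
qed

section \<open>Translation to the information matrix, and the optimality proof\<close>

lemma dvec_nth:
  assumes "a < p12 v K + p3 v K"
  shows "dvec v K x ! a = phi_diff v K x ((idx1 v K @ idx2 v K @ idx3 v K) ! a)"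
proof -
  have "length (idx1 v K @ idx2 v K @ idx3 v K) = p12 v K + p3 v K"
    using length_idx12[of v K] length_idx3[of v K] by simp
  then show ?thesis using assms by (simp add: dvec_def fvec_eq_map_phi phi_diff_def del: map_append length_append append_assoc)
qed

lemma dvec_nth_low:
  assumes "a < p12 v K"
  shows "\<exists>c \<in> effects v K 1 \<union> effects v K 2. \<forall>x. dvec v K x ! a = phi_diff v K x c"
proof -
  have "(idx1 v K @ idx2 v K @ idx3 v K) ! a = (idx1 v K @ idx2 v K) ! a"
    using assms nth_append[of "idx1 v K @ idx2 v K" "idx3 v K" a] by (simp only: length_idx12 append_assoc if_True)
  moreover have "(idx1 v K @ idx2 v K) ! a \<in> set (idx1 v K @ idx2 v K)"
    using assms by (intro nth_mem) (simp only: length_idx12)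
  ultimately show ?thesis using set_idx12_subset[of v K] assms dvec_nth[of a v K]
    by (intro bexI[of _ "(idx1 v K @ idx2 v K) ! a"]) auto
qed

lemma dvec_nth_high:
  assumes "b < p3 v K"
  shows "dvec v K x ! (p12 v K + b) = phi_diff v K x (idx3 v K ! b)"
  using assms dvec_nth[of "p12 v K + b" v K x] nth_append_length_plus[of "idx1 v K @ idx2 v K" "idx3 v K" b]
  by (simp only: length_idx12 append_assoc add_less_cancel_left)

lemma sum_uniform_design:
  "(\<Sum>x\<in>design_region v K S. uniform_design v K S d x * h x) =
    (\<Sum>x\<in>design_region_d v K S d. h x) / real (card (design_region_d v K S d))"
proof -
  have "(\<Sum>x\<in>design_region v K S. uniform_design v K S d x * h x) =
      (\<Sum>x\<in>design_region_d v K S d. uniform_design v K S d x * h x)"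
    using design_region_d_subset by (intro sum.mono_neutral_right) (auto simp: uniform_design_def)
  also have "\<dots> = (\<Sum>x\<in>design_region_d v K S d. h x / real (card (design_region_d v K S d)))"
    by (rule sum.cong) (auto simp: uniform_design_def)
  finally show ?thesis by (simp add: sum_divide_distrib)
qed

lemma uniform_design_is_design:
  assumes "2 \<le> v" "d \<le> S" "S \<le> K"
  shows "is_design v K S (uniform_design v K S d)"
proof -
  have "card (design_region_d v K S d) \<noteq> 0" using design_region_d_nonempty[OF assms] by simp
  then have "(\<Sum>x\<in>design_region v K S. uniform_design v K S d x) = 1"
    using sum_uniform_design[of v K S d "\<lambda>_. 1"] by simp
  then show ?thesis using design_region_d_subset[of v K S d]
    unfolding is_design_def by (auto simp: uniform_design_def[of _ _ _ _ "(_, _)"])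
qed

lemma info_mat_eq_gram:
  "info_mat v K S \<xi> = gram (design_region v K S) \<xi> (\<lambda>x a. dvec v K x ! a) (p12 v K + p3 v K)"
  by (simp add: info_mat_def gram_def)

text \<open>At depth 1 the polynomial factors. Positivity there makes the maximum of
  \<open>h3\<close> positive, which yields an invertible block for the optimal design.\<close>

lemma h3_one_pos:
  assumes "2 \<le> v" "3 \<le> K" "3 \<le> S"
  shows "0 < h3 v K S 1"
proof -
  have "h3 v K S 1 = 3 * (real S - 1) * (real S - 2) * (real v - 1)\<^sup>2 /
      (4 * (real v)\<^sup>2 * real K * (real K - 1) * (real K - 2))"
    by (simp add: h3_def Let_def algebra_simps power2_eq_square)
  also have "0 < \<dots>" using assms by (intro divide_pos_pos mult_pos_pos) auto
  finally show ?thesis .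
qed

theorem theorem1:
  fixes v K S dstar :: nat
  assumes "v \<ge> 2" and "K \<ge> 3" and "3 \<le> S" and "S \<le> K"
    and "dstar \<in> {1..S}" and "\<forall>d\<in>{1..S}. h3 v K S d \<le> h3 v K S dstar"
  shows "is_design v K S (uniform_design v K S dstar)
    \<and> (\<forall>\<xi>. is_design v K S \<xi> \<longrightarrow>
          det (info_mat3 v K S \<xi>) \<le> det (info_mat3 v K S (uniform_design v K S dstar)))"
proof (intro conjI allI impI)
  show unif: "is_design v K S (uniform_design v K S dstar)"
    using assms by (intro uniform_design_is_design) auto
  fix \<xi> assume \<xi>: "is_design v K S \<xi>"
  define X where "X = design_region v K S"
  define \<eta> where "\<eta> = uniform_design v K S dstar"
  define q r where "q = p12 v K" and "r = p3 v K"
  define e where "e = (!) (idx3 v K)"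
  \<comment> \<open>Ratio between the second-order block of the design and \<open>cov\<close>; by
    \<open>mass_eq\<close> the triple \<open>{..<3}\<close> represents all triples.\<close>
  define c where "c = mass v K S dstar {..<3} / real (card (design_region_d v K S dstar))"
  define B where "B = 4 * real K * (real K - 1) * (real K - 2) / 3"
  have v: "2 \<le> v" "0 < v" using assms by auto
  have r: "0 < r" using assms by (simp add: r_def p3_def)
  have B: "0 < B" using assms by (simp add: B_def)
  have e: "e a \<in> effects v K 3" if "a < r" for a
    using that nth_mem[of a "idx3 v K"] by (simp add: set_idx3 length_idx3 r_def e_def)
  have low: "(\<Sum>x\<in>X. \<eta> x * dvec v K x ! a * dvec v K x ! (q + b)) = 0" if ab: "a < q" "b < r" for a b
  proof -
    obtain a' where a': "a' \<in> effects v K 1 \<union> effects v K 2" "\<And>x. dvec v K x ! a = phi_diff v K x a'"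
      using dvec_nth_low[of a v K] ab by (auto simp: q_def)
    \<comment> \<open>One or two attributes can never be the support of a second-order effect, so
      \<open>cov\<close> vanishes.\<close>
    have ne: "supp a' \<noteq> supp (e b)" using a'(1) e[OF ab(2)] by (auto simp: effects_def)
    have l: "length a' = K" "\<And>k. k < K \<Longrightarrow> a' ! k < v" using a'(1) by (auto simp: effects_def)
    have "(\<Sum>x\<in>design_region_d v K S dstar. phi_diff v K x a' * phi_diff v K x (e b)) = 0"
      using sum_phi_diff[OF v(1) l effectsD(1,2)[OF e[OF ab(2)]]] cov_eq_0[OF l(1) effectsD(1)[OF e[OF ab(2)]] ne]
      by simp
    moreover have "(\<Sum>x\<in>X. \<eta> x * dvec v K x ! a * dvec v K x ! (q + b)) =
        (\<Sum>x\<in>X. \<eta> x * (phi_diff v K x a' * phi_diff v K x (e b)))"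
      using ab by (simp add: a'(2) dvec_nth_high q_def r_def e_def mult.assoc)
    ultimately show ?thesis by (simp add: X_def \<eta>_def sum_uniform_design)
  qed
  have P: "(\<Sum>x\<in>X. \<eta> x * phi_diff v K x (e a) * phi_diff v K x (e b)) = c * cov K (e a) (e b)"
    if ab: "a < r" "b < r" for a b
  proof -
    note ea = effectsD[OF e[OF ab(1)]] and eb = effectsD[OF e[OF ab(2)]]
    have m: "mass v K S dstar (supp (e a)) = mass v K S dstar {..<3}"
      using ea assms by (intro mass_eq) auto
    have "(\<Sum>x\<in>X. \<eta> x * phi_diff v K x (e a) * phi_diff v K x (e b)) =
        (\<Sum>x\<in>design_region_d v K S dstar. phi_diff v K x (e a) * phi_diff v K x (e b)) /
          real (card (design_region_d v K S dstar))"
      by (simp add: X_def \<eta>_def mult.assoc sum_uniform_design)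
    then show ?thesis by (simp add: sum_phi_diff[OF v(1) ea(1,2) eb(1,2)] m c_def)
  qed
  have inverse: "(\<Sum>b<r. cov K (e a) (e b) * prec v K (e b) (e d)) = (if a = d then 1 else 0)"
    if "a < r" "d < r" for a d
  proof -
    have "(\<Sum>b<r. cov K (e a) (e b) * prec v K (e b) (e d)) = (if e a = e d then 1 else 0)"
      using sum_idx3[OF v(2), where h = "\<lambda>b. cov K (e a) b * prec v K b (e d)"]
        cov_mult_prec[OF v(2) e[OF that(1)] e[OF that(2)]] by (simp add: r_def e_def)
    moreover have "e a = e d \<longleftrightarrow> a = d"
      using that distinct_idx3[OF v(2)] by (simp add: e_def r_def length_idx3 nth_eq_iff_index_eq)
    ultimately show ?thesis by simp
  qed
  have form: "(\<Sum>a<r. \<Sum>b<r. phi_diff v K x (e a) * prec v K (e a) (e b) * phi_diff v K x (e b)) =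
      B * h3 v K S (card (diff_set x))" if "x \<in> X" for x
  proof -
    have "(\<Sum>a<r. \<Sum>b<r. phi_diff v K x (e a) * prec v K (e a) (e b) * phi_diff v K x (e b)) =
      (\<Sum>a\<in>effects v K 3. \<Sum>b\<in>effects v K 3. phi_diff v K x a * prec v K a b * phi_diff v K x b)"
      unfolding e_def r_def by (subst sum_idx3[OF v(2), symmetric])+ simp
    then show ?thesis using prec_quadratic_form[OF v(1) assms(2), of x S] that by (simp add: X_def B_def)
  qed
  \<comment> \<open>The constant \<open>c\<close> is read off from the trace of the identity matrix.\<close>
  have cr: "c * real r = B * h3 v K S dstar"
  proof -
    have "c * real r = (\<Sum>a<r. \<Sum>b<r. c * cov K (e a) (e b) * prec v K (e b) (e a))"
      using inverse by (simp add: mult.assoc sum_distrib_left[symmetric])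
    also have "\<dots> = (\<Sum>a<r. \<Sum>b<r. \<Sum>x\<in>X. \<eta> x * (phi_diff v K x (e b) * prec v K (e b) (e a) * phi_diff v K x (e a)))"
      by (intro sum.cong[OF refl]) (simp add: P[symmetric] sum_distrib_left sum_distrib_right mult_ac)
    also have "\<dots> = (\<Sum>b<r. \<Sum>a<r. \<Sum>x\<in>X. \<eta> x * (phi_diff v K x (e b) * prec v K (e b) (e a) * phi_diff v K x (e a)))"
      by (rule sum.swap)
    also have "\<dots> = (\<Sum>b<r. \<Sum>x\<in>X. \<Sum>a<r. \<eta> x * (phi_diff v K x (e b) * prec v K (e b) (e a) * phi_diff v K x (e a)))"
      by (rule sum.cong[OF refl sum.swap])
    also have "\<dots> = (\<Sum>x\<in>X. \<Sum>b<r. \<Sum>a<r. \<eta> x * (phi_diff v K x (e b) * prec v K (e b) (e a) * phi_diff v K x (e a)))"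
      by (rule sum.swap)
    also have "\<dots> = (\<Sum>x\<in>X. \<eta> x * (B * h3 v K S (card (diff_set x))))"
      using form by (simp add: sum_distrib_left[symmetric])
    \<comment> \<open>The weights are carried by pairs of depth \<open>dstar\<close>, on which the
      form is constant.\<close>
    also have "\<dots> = (\<Sum>x\<in>X. \<eta> x * (B * h3 v K S dstar))"
      by (rule sum.cong[OF refl]) (auto simp: \<eta>_def uniform_design_def dest: design_region_dD(2))
    also have "\<dots> = B * h3 v K S dstar"
      using unif by (simp add: sum_distrib_right[symmetric] is_design_def X_def \<eta>_def)
    finally show ?thesis .
  qed
  have "0 < h3 v K S 1" using assms h3_one_pos by simp
  also have "\<dots> \<le> h3 v K S dstar" using assms by auto
  finally have h_pos: "0 < h3 v K S dstar" .
  \<comment> \<open>Positivity of \<open>c\<close> comes from the trace identity \<open>cr\<close>,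
    without evaluating \<open>mass\<close>.\<close>
  then have c: "0 < c" using cr B r by (metis mult_pos_pos of_nat_0_less_iff zero_less_mult_pos2)
  have h_max: "h3 v K S (card (diff_set x)) \<le> h3 v K S dstar" if "x \<in> X" for x
  proof -
    have "finite (supp (fst x))" by (simp add: supp_def)
    then have "card (diff_set x) \<le> S"
      using card_mono[OF _ diff_set_subset_supp, of x v K S] that by (auto simp: X_def design_region_iff)
    \<comment> \<open>Depth 0 belongs to the design region but not to the range of maximisation;
      there \<open>h3\<close> is 0, below the positive maximum.\<close>
    moreover have "h3 v K S 0 = 0" by (simp add: h3_def Let_def)
    ultimately show ?thesis using assms(6) h_pos by (cases "card (diff_set x) = 0") auto
  qed
  define R where "R = mat r r (\<lambda>(a, b). prec v K (e a) (e b) / c)"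
  show "det (info_mat3 v K S \<xi>) \<le> det (info_mat3 v K S (uniform_design v K S dstar))"
    unfolding info_mat3_def info_mat_eq_gram X_def[symmetric] q_def[symmetric] r_def[symmetric] \<eta>_def[symmetric]
  proof (rule det_schur_compl_gram_le)
    show "finite X" by (simp add: X_def)
    show "0 \<le> \<xi> x" "0 \<le> \<eta> x" for x
      using \<xi> unif unfolding is_design_def \<eta>_def by blast+
    show "sum \<xi> X = 1" using \<xi> by (simp add: is_design_def X_def)
    show "R \<in> carrier_mat r r" by (simp add: R_def)
    show "(\<Sum>x\<in>X. \<eta> x * dvec v K x ! a * dvec v K x ! (q + b)) = 0" if "a < q" "b < r" for a b
      using low that .
    show "gram X \<eta> (\<lambda>x b. dvec v K x ! (q + b)) r * R = 1\<^sub>m r"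
    proof (rule eq_matI)
      fix a d assume "a < dim_row (1\<^sub>m r)" "d < dim_col (1\<^sub>m r)"
      then have ad: "a < r" "d < r" by auto
      have "(gram X \<eta> (\<lambda>x b. dvec v K x ! (q + b)) r * R) $$ (a, d) =
          (\<Sum>b<r. c * cov K (e a) (e b) * (prec v K (e b) (e d) / c))"
        using ad P by (subst index_mult_mat_sum[of _ r r])
          (simp_all add: R_def dvec_nth_high q_def r_def e_def)
      also have "\<dots> = (\<Sum>b<r. cov K (e a) (e b) * prec v K (e b) (e d))" using c by simp
      finally show "(gram X \<eta> (\<lambda>x b. dvec v K x ! (q + b)) r * R) $$ (a, d) = 1\<^sub>m r $$ (a, d)"
        using inverse ad by simp
    qed (simp_all add: R_def)
    fix x assume x: "x \<in> X"
    have "(\<Sum>a<r. \<Sum>b<r. dvec v K x ! (q + a) * R $$ (a, b) * dvec v K x ! (q + b)) =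
        (\<Sum>a<r. \<Sum>b<r. phi_diff v K x (e a) * prec v K (e a) (e b) * phi_diff v K x (e b)) / c"
      unfolding sum_divide_distrib
      by (intro sum.cong[OF refl]) (simp add: R_def dvec_nth_high q_def r_def e_def)
    also have "\<dots> = B * h3 v K S (card (diff_set x)) / c" using form[OF x] by simp
    also have "\<dots> \<le> B * h3 v K S dstar / c" using h_max[OF x] B c by (intro divide_right_mono mult_left_mono) auto
    \<comment> \<open>By \<open>cr\<close> the bound is attained exactly at the depth
      \<open>dstar\<close>, which is what makes the trace bound equal to the order
      \<open>r\<close>.\<close>
    also have "\<dots> = real r" using cr c by (simp add: field_simps)
    finally show "(\<Sum>a<r. \<Sum>b<r. dvec v K x ! (q + a) * R $$ (a, b) * dvec v K x ! (q + b)) \<le> real r" .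
  qed
qed

end
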